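(* Let $r>a\ge 1$ be coprime integers, and let $Q$ be the quiver of the reconstruction algebra of the cyclic group $\frac1r(1,a)$, with $\mathscr{R}=\mathbb{C}[\mathrm{Rep}(\mathbb{C}Q,\delta)]$, $\delta=(1,\dots,1)$, and $G=\prod_{q\in Q_0}\mathbb{C}^*$ acting on $\mathscr{R}$. Then there is an isomorphism of $\mathbb{C}$-algebras $$\mathscr{R}^G\;\cong\;\frac{\mathbb{C}[\mathsf{z}]}{\mathrm{QDet}(\mathsf{z})},$$ where $\mathbb{C}[\mathsf{z}]$ is the polynomial ring in the variables $z_{i,j}$ and $\mathrm{QDet}(\mathsf{z})$ is the ideal generated by the quasiminors, both described in the context.
   Context: Continued fractions. Let $r>a\ge1$ be coprime integers. Write the Hirzebruch--Jung expansions $\frac ra=[\alpha_1,\dots,\alpha_n]=\alpha_1-\frac{1}{\alpha_2-\frac{1}{\cdots}}$ and $\frac{r}{r-a}=[\beta_1,\dots,\beta_m]$ (all $\alpha_i,\beta_i\ge2$). One has $m=1+\sum_i(\alpha_i-2)$; put $e=m+2$. Quiver $Q$. Vertices $0,1,\dots,n$. If $n\ge2$ (equivalently $a>1$): clockwise arrows $c_{0n}:0\to n$ and $c_{i,i-1}:i\to i-1$ ($1\le i\le n$); anticlockwise arrows $a_{i,i+1}:i\to i+1$ ($0\le i\le n-1$) and $a_{n0}:n\to0$; and, for each $i\in\{1,\dots,n\}$, $\alpha_i-2$ extra arrows $i\to 0$. The extra arrows are labelled $k_1,\dots,k_{m-1}$ so that their tails are weakly increasing; put $k_0:=c_{10}$,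 $k_m:=a_{n0}$ (the same arrows, renamed). For $1\le v\le n$ put $C_{0v}=c_{0n}c_{n,n-1}\cdots c_{v+1,v}$ and $A_{0v}=a_{01}a_{12}\cdots a_{v-1,v}$. If $n=1$ (equivalently $a=1$): two arrows $c_1,c_2:0\to1$ and $r=m+1$ arrows $k_0,\dots,k_m:1\to0$; put $C_{01}=c_1$, $A_{01}=c_2$. In all cases $l_h$ denotes the tail of $k_h$ ($0\le h\le m$), so $l_0=1$, $l_m=n$; put $C_{00}=C_{01}k_0$, $A_{00}=A_{0n}k_m$. One has $\beta_t=l_t-l_{t-1}+2$ for $1\le t\le m$. Invariants. $\mathscr{R}$ is the polynomial ring over $\mathbb{C}$ in the arrows of $Q$; $\mu=(\mu_q)\in G$ acts by $\mu\cdot p=\mu_{t(p)}^{-1}\,p\,\mu_{h(p)}$ on an arrow $p$ with tail $t(p)$ and head $h(p)$. Variables. Put $s_t=\beta_t-1$ for $1\le t\le m$ and $s_{m+1}=0$. $\mathbb{C}[\mathsf z]$ is the polynomial ring in the variables $z_{0,0}$, $z_{i,j}$ ($1\le i\le m$, $0\le j\le s_i$), and $z_{m+1,0}$. Quasiminors. For $1\le i\le m+1$ put $x_i=z_{i-1,0}$, $y_i=z_{i,s_i}$, and for $1\le t\le m$ put $W_t=z_{t,s_t-1}z_{t,s_t-2}\cdots z_{t,1}$ (equal to $1$ if $s_t=1$). $\mathrm{QDet}(\mathsf z)$ is generated by the quasiminors $x_iy_j-y_i\big(\prod_{t=i}^{j-1}W_t\big)x_j$ for $1\le i<j\le m+1$.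 *)

theory Defs
  imports
    Complex_Main
    "HOL-Library.Poly_Mapping"
    "HOL-Library.FuncSet"
    "HOL-Algebra.QuotRing"
    "Graph_Theory.Digraph"
begin

section \<open>Hirzebruch--Jung continued fractions\<close>

fun hj_val :: "nat list \<Rightarrow> rat" where
  "hj_val [] = 0"
| "hj_val [b] = of_nat b"
| "hj_val (b # c # bs) = of_nat b - 1 / hj_val (c # bs)"

definition hj_expansion :: "rat \<Rightarrow> nat list \<Rightarrow> bool" where
  "hj_expansion x bs \<longleftrightarrow> bs \<noteq> [] \<and> (\<forall>b\<in>set bs. 2 \<le> b) \<and> hj_val bs = x"

lemma hj_val_Cons: "bs \<noteq> [] \<Longrightarrow> hj_val (b # bs) = of_nat b - 1 / hj_val bs"
  by (cases bs) auto

lemma hj_val_gt_1: "bs \<noteq> [] \<Longrightarrow> \<forall>b\<in>set bs. 2 \<le> b \<Longrightarrow> 1 < hj_val bs"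
proof (induction bs rule: hj_val.induct)
  case (3 b c bs)
  then have "1 < hj_val (c # bs)" by simp
  then have "1 / hj_val (c # bs) < 1" by simp
  moreover have "(2::rat) \<le> of_nat b"
    using "3.prems" by (metis list.set_intros(1) of_nat_le_iff of_nat_numeral)
  ultimately show ?case by simp
qed auto

lemma hj_expansion_exists:
  "0 < a \<Longrightarrow> a < r \<Longrightarrow> \<exists>bs. hj_expansion (of_nat r / of_nat a) bs"
proof (induction a arbitrary: r rule: less_induct)
  case (less a)
  show ?case
  proof (cases "a dvd r")
    case True
    then obtain q where q: "r = a * q" by blast
    with less.prems have "2 \<le> q" by (cases q; cases "q - 1") auto
    with q less.prems have "hj_expansion (of_nat r / of_nat a) [q]"
      by (simp add: hj_expansion_def)
    then show ?thesis by blast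
  next
    case False
    define q where "q = r div a"
    define s where "s = a - r mod a"
    have m: "0 < r mod a" "r mod a < a"
      using False less.prems by (auto simp: dvd_eq_mod_eq_0)
    have s: "0 < s" "s < a" using m by (auto simp: s_def)
    have "r = q * a + r mod a" "a = s + r mod a" using m by (simp_all add: s_def q_def)
    then have rq: "r + s = (q + 1) * a" by (simp only: add_mult_distrib)
    have q1: "1 \<le> q"
      using less.prems by (simp add: q_def Suc_le_eq div_greater_zero_iff)
    obtain bs where bs: "hj_expansion (of_nat a / of_nat s) bs"
      using less.IH[OF s(2,1) s(2)] by blast
    have "(of_nat r :: rat) = of_nat (q + 1) * of_nat a - of_nat s"
      using rq by (metis add_diff_cancel_right' of_nat_add of_nat_mult)
    then have "(of_nat r / of_nat a :: rat) = of_nat (q + 1) - of_nat s / of_nat a"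
      using less.prems by (simp add: field_simps)
    then have "hj_expansion (of_nat r / of_nat a) ((q + 1) # bs)"
      using bs q1 by (auto simp: hj_expansion_def hj_val_Cons)
    then show ?thesis by blast
  qed
qed

lemma hj_expansion_unique:
  "hj_expansion x bs \<Longrightarrow> hj_expansion x cs \<Longrightarrow> bs = cs"
proof (induction bs arbitrary: x cs)
  case Nil
  then show ?case by (simp add: hj_expansion_def)
next
  case (Cons b bs)
  have *: "\<lceil>x\<rceil> = int d \<and> (ds = [] \<longleftrightarrow> x = of_nat d) \<and>
      (ds \<noteq> [] \<longrightarrow> hj_expansion (1 / (of_nat d - x)) ds)"
    if "hj_expansion x (d # ds)" for d ds
  proof (cases "ds = []")
    case True
    with that show ?thesis by (auto simp: hj_expansion_def)
  next
    case False
    with that have 1: "1 < hj_val ds" by (auto simp: hj_expansion_def intro: hj_val_gt_1)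
    then have "0 < 1 / hj_val ds" "1 / hj_val ds < 1" by auto
    moreover have x: "x = of_nat d - 1 / hj_val ds"
      using that False by (simp add: hj_expansion_def hj_val_Cons)
    ultimately have "x < of_nat d" "of_nat d - 1 < x" by auto
    then have "\<lceil>x\<rceil> = int d" by (intro ceiling_unique) auto
    then show ?thesis using that False x \<open>x < of_nat d\<close> by (auto simp: hj_expansion_def)
  qed
  obtain c cs' where cs: "cs = c # cs'"
    using Cons.prems(2) by (cases cs) (auto simp: hj_expansion_def)
  have "b = c" "bs = [] \<longleftrightarrow> cs' = []"
    using *[OF Cons.prems(1)] *[OF Cons.prems(2)[unfolded cs]] by auto
  then show ?case
    using Cons.IH *[OF Cons.prems(1)] *[OF Cons.prems(2)[unfolded cs]] cs by blast
qed


section \<open>The quiver of the reconstruction algebra\<close>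

text \<open>
  The clockwise arrow with tail \<open>i\<close> is \<open>Cw i\<close>, so \<open>Cw 0\<close> is \<open>c\<^sub>0\<^sub>n\<close> and \<open>Cw i\<close> is
  \<open>c\<^sub>i\<^sub>,\<^sub>i\<^sub>-\<^sub>1\<close>; the anticlockwise arrow with tail \<open>i\<close> is \<open>Acw i\<close>, so \<open>Acw n\<close> is \<open>a\<^sub>n\<^sub>0\<close>.
  The extra arrows \<open>k\<^sub>1, \<dots>, k\<^sub>m\<^sub>-\<^sub>1\<close> are the \<open>Extra i j\<close> in lexicographic order, and
  \<open>k\<^sub>0 = Cw 1\<close>, \<open>k\<^sub>m = Acw n\<close>.

  For \<open>n = 1\<close> this gives the two arrows \<open>Cw 0\<close>, \<open>Acw 0\<close> from 0 to 1 and, since then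
  \<open>\<alpha>\<^sub>1 = r\<close>, the \<open>2 + (r - 2) = r\<close> arrows \<open>Cw 1\<close>, \<open>Extra 1 j\<close>, \<open>Acw 1\<close> from 1 to 0,
  which is the quiver of the case \<open>a = 1\<close>.
\<close>

datatype arrow = Cw nat | Acw nat | Extra nat nat

definition recon_quiver :: "nat list \<Rightarrow> (nat, arrow) pre_digraph" where
  "recon_quiver \<alpha> = (let n = length \<alpha> in
    \<lparr>verts = {0..n},
     arcs = Cw ` {0..n} \<union> Acw ` {0..n}
       \<union> {Extra i j |i j. 1 \<le> i \<and> i \<le> n \<and> 1 \<le> j \<and> j \<le> \<alpha> ! (i - 1) - 2},
     tail = (\<lambda>p. case p of Cw i \<Rightarrow> i | Acw i \<Rightarrow> i | Extra i j \<Rightarrow> i),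
     head = (\<lambda>p. case p of
         Cw i \<Rightarrow> if i = 0 then n else i - 1
       | Acw i \<Rightarrow> if i = n then 0 else i + 1
       | Extra i j \<Rightarrow> 0)\<rparr>)"

lemma fin_digraph_recon_quiver: "fin_digraph (recon_quiver \<alpha>)"
proof
  have "{Extra i j |i j. 1 \<le> i \<and> i \<le> length \<alpha> \<and> 1 \<le> j \<and> j \<le> \<alpha> ! (i - 1) - 2}
      = (\<Union>i\<in>{1..length \<alpha>}. Extra i ` {1..\<alpha> ! (i - 1) - 2})" by auto
  then show "finite (arcs (recon_quiver \<alpha>))" by (simp add: recon_quiver_def Let_def)
qed (auto simp: recon_quiver_def Let_def split: if_splits)


section \<open>Polynomial rings over the complex numbers\<close>

type_synonym 'v cpoly = "('v \<Rightarrow>\<^sub>0 nat) \<Rightarrow>\<^sub>0 complex"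

definition Var :: "'v \<Rightarrow> 'v cpoly" where
  "Var v = Poly_Mapping.single (Poly_Mapping.single v 1) 1"

definition Const :: "complex \<Rightarrow> 'v cpoly" where
  "Const c = Poly_Mapping.single 0 c"

definition poly_ring :: "'v set \<Rightarrow> 'v cpoly ring" where
  "poly_ring V = \<lparr>carrier = {f. \<forall>m\<in>Poly_Mapping.keys f. Poly_Mapping.keys m \<subseteq> V},
     mult = (*), one = 1, zero = 0, add = (+)\<rparr>"

text \<open>\<open>poly_subst \<sigma>\<close> is the \<open>\<complex>\<close>-algebra homomorphism that maps each variable \<open>v\<close> to \<open>\<sigma> v\<close>.\<close>

definition poly_subst :: "('v \<Rightarrow> 'w cpoly) \<Rightarrow> 'v cpoly \<Rightarrow> 'w cpoly" where
  "poly_subst \<sigma> f = (\<Sum>m\<in>Poly_Mapping.keys f.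
     Const (Poly_Mapping.lookup f m) *
     (\<Prod>v\<in>Poly_Mapping.keys m. \<sigma> v ^ Poly_Mapping.lookup m v))"

lemma cring_poly_ring: "cring (poly_ring V)"
proof (rule cringI)
  show "abelian_group (poly_ring V)"
  proof (rule abelian_groupI)
    fix f assume "f \<in> carrier (poly_ring V)"
    then have "- f \<in> carrier (poly_ring V)" by (simp add: poly_ring_def)
    then show "\<exists>g\<in>carrier (poly_ring V). g \<oplus>\<^bsub>poly_ring V\<^esub> f = \<zero>\<^bsub>poly_ring V\<^esub>"
      by (intro bexI[of _ "- f"]) (auto simp: poly_ring_def)
  qed (use keys_add in \<open>fastforce simp: poly_ring_def algebra_simps\<close>)+
  show "Group.comm_monoid (poly_ring V)"
  proof (rule comm_monoidI)
    fix f g assume fg: "f \<in> carrier (poly_ring V)" "g \<in> carrier (poly_ring V)"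
    have "Poly_Mapping.keys m \<subseteq> V" if "m \<in> Poly_Mapping.keys (f * g)" for m
    proof -
      obtain p q where "m = p + q" "p \<in> Poly_Mapping.keys f" "q \<in> Poly_Mapping.keys g"
        using \<open>m \<in> _\<close> keys_mult[of f g] by blast
      then show ?thesis
        using fg keys_add[of p q] by (fastforce simp: poly_ring_def)
    qed
    then show "f \<otimes>\<^bsub>poly_ring V\<^esub> g \<in> carrier (poly_ring V)" by (simp add: poly_ring_def)
  qed (auto simp: poly_ring_def algebra_simps)
qed (simp add: poly_ring_def algebra_simps)

text \<open>
  Isomorphism of commutative \<open>\<complex>\<close>-algebras, an algebra being a ring \<open>A\<close> with its structure
  map \<open>\<eta> : \<complex> \<rightarrow> A\<close>.
\<close>

definition calg_iso ::
  "('a, 'x) ring_scheme \<Rightarrow> (complex \<Rightarrow> 'a) \<Rightarrow> ('b, 'y) ring_scheme \<Rightarrow> (complex \<Rightarrow> 'b) \<Rightarrow> bool"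
  where "calg_iso A \<eta> B \<theta> \<longleftrightarrow> (\<exists>\<phi>\<in>ring_iso A B. \<forall>c. \<phi> (\<eta> c) = \<theta> c)"


section \<open>The ring of invariants\<close>

text \<open>The group \<open>G\<close>, a product of copies of \<open>\<complex>\<^sup>*\<close> indexed by the vertices.\<close>

definition torus :: "('q, 'p) pre_digraph \<Rightarrow> ('q \<Rightarrow> complex) set" where
  "torus Q = (\<Pi>\<^sub>E q\<in>verts Q. UNIV - {0})"

definition torus_act :: "('q, 'p) pre_digraph \<Rightarrow> ('q \<Rightarrow> complex) \<Rightarrow> 'p cpoly \<Rightarrow> 'p cpoly" where
  "torus_act Q \<mu> =
     poly_subst (\<lambda>p. Const (inverse (\<mu> (tail Q p))) * Var p * Const (\<mu> (head Q p)))"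

definition invariant_ring :: "('q, 'p) pre_digraph \<Rightarrow> 'p cpoly ring" where
  "invariant_ring Q = (poly_ring (arcs Q))
     \<lparr>carrier := {f \<in> carrier (poly_ring (arcs Q)). \<forall>\<mu>\<in>torus Q. torus_act Q \<mu> f = f}\<rparr>"


section \<open>Quasiminors\<close>

text \<open>
  Here \<open>\<beta>\<close> is the list \<open>[\<beta>\<^sub>1, \<dots>, \<beta>\<^sub>m]\<close>, so \<open>\<beta> ! (t - 1)\<close> is \<open>\<beta>\<^sub>t\<close>, and the variable
  \<open>z\<^sub>i\<^sub>,\<^sub>j\<close> is \<open>Var (i, j)\<close>.
\<close>

definition s_idx :: "nat list \<Rightarrow> nat \<Rightarrow> nat" where
  "s_idx \<beta> t = (if 1 \<le> t \<and> t \<le> length \<beta> then \<beta> ! (t - 1) - 1 else 0)"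

definition z_vars :: "nat list \<Rightarrow> (nat \<times> nat) set" where
  "z_vars \<beta> = {(0, 0)} \<union> {(i, j). 1 \<le> i \<and> i \<le> length \<beta> \<and> j \<le> s_idx \<beta> i}
     \<union> {(length \<beta> + 1, 0)}"

definition x_var :: "nat \<Rightarrow> (nat \<times> nat) cpoly" where
  "x_var i = Var (i - 1, 0)"

definition y_var :: "nat list \<Rightarrow> nat \<Rightarrow> (nat \<times> nat) cpoly" where
  "y_var \<beta> i = Var (i, s_idx \<beta> i)"

definition W_prod :: "nat list \<Rightarrow> nat \<Rightarrow> (nat \<times> nat) cpoly" where
  "W_prod \<beta> t = (\<Prod>j\<in>{1..<s_idx \<beta> t}. Var (t, j))"

definition quasiminor :: "nat list \<Rightarrow> nat \<Rightarrow> nat \<Rightarrow> (nat \<times> nat) cpoly" where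
  "quasiminor \<beta> i j =
     x_var i * y_var \<beta> j - y_var \<beta> i * (\<Prod>t\<in>{i..<j}. W_prod \<beta> t) * x_var j"

definition QDet :: "nat list \<Rightarrow> (nat \<times> nat) cpoly set" where
  "QDet \<beta> = genideal (poly_ring (z_vars \<beta>))
     {quasiminor \<beta> i j |i j. 1 \<le> i \<and> i < j \<and> j \<le> length \<beta> + 1}"

end

theory Submission
  imports Defs
begin

text \<open>
  Torus invariants are spanned by the monomials whose exponents are circulations on the quiver. The
  variables of the paper correspond to cycles: \<open>x\<^sub>h\<^sub>+\<^sub>1 = C\<^sub>0\<^sub>l k\<^sub>h\<close> and \<open>y\<^sub>h\<^sub>+\<^sub>1 = A\<^sub>0\<^sub>l k\<^sub>h\<close>, where \<open>l\<close>
  is the tail of \<open>k\<^sub>h\<close>, while the factors of the \<open>W\<^sub>t\<close> are the two-cycles between neighbouring vertices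
  \<open>v\<close>, \<open>v + 1\<close> with \<open>1 \<le> v < n\<close>; the identity \<open>\<beta>\<^sub>t = l\<^sub>t - l\<^sub>t\<^sub>-\<^sub>1 + 2\<close> (Riemenschneider duality) makes the
  count of these come out right. Used as a rewrite rule \<open>x\<^sub>i y\<^sub>j \<mapsto> y\<^sub>i W x\<^sub>j\<close>, a quasiminor moves the \<open>x\<close>-variables
  to the right, so every monomial is congruent to one in which no \<open>x\<^sub>i y\<^sub>j\<close> with \<open>i < j\<close> occurs. In such
  a normal monomial the \<open>x\<close>-exponents fill up the multiplicities of the \<open>k\<^sub>h\<close> from the right until the
  multiplicity of \<open>c\<^sub>0\<^sub>n\<close> is exhausted. So it is determined by its circulation, and by flow conservation
  every circulation is reached.
\<close>


section \<open>Toric presentations of monomial subalgebras\<close>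

definition push :: "('a \<Rightarrow> 'b) \<Rightarrow> ('a \<Rightarrow>\<^sub>0 'c::comm_monoid_add) \<Rightarrow> 'b \<Rightarrow>\<^sub>0 'c" where
  "push g f = (\<Sum>m\<in>Poly_Mapping.keys f. Poly_Mapping.single (g m) (Poly_Mapping.lookup f m))"

lemma push_superset:
  assumes "finite A" "Poly_Mapping.keys f \<subseteq> A"
  shows "push g f = (\<Sum>m\<in>A. Poly_Mapping.single (g m) (Poly_Mapping.lookup f m))"
  unfolding push_def using assms by (intro sum.mono_neutral_left) (auto simp: in_keys_iff)

lemma push_zero [simp]: "push g 0 = 0"
  by (simp add: push_def)

lemma push_single [simp]: "push g (Poly_Mapping.single m c) = Poly_Mapping.single (g m) c"
  by (subst push_superset[of "{m}"]) auto

lemma push_add: "push g (f + h) = push g f + push g h"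
proof -
  let ?A = "Poly_Mapping.keys f \<union> Poly_Mapping.keys h"
  have "push g (f + h) = (\<Sum>m\<in>?A. Poly_Mapping.single (g m) (Poly_Mapping.lookup (f + h) m))"
    by (rule push_superset) (use keys_add[of f h] in auto)
  also have "\<dots> = push g f + push g h"
    by (simp add: push_superset[of ?A] lookup_add single_add sum.distrib)
  finally show ?thesis .
qed

lemma push_diff: "push g (f - h) = push g f - push g h" for f h :: "'a \<Rightarrow>\<^sub>0 'c::ab_group_add"
  using push_add[of g "f - h" h] by (simp add: algebra_simps)

lemma push_sum: "push g (\<Sum>i\<in>I. f i) = (\<Sum>i\<in>I. push g (f i))"
  by (induction I rule: infinite_finite_induct) (auto simp: push_add)

lemma poly_mapping_expand:
  "f = (\<Sum>m\<in>Poly_Mapping.keys f. Poly_Mapping.single m (Poly_Mapping.lookup f m))"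
proof (rule poly_mapping_eqI)
  fix k
  show "Poly_Mapping.lookup f k =
    Poly_Mapping.lookup (\<Sum>m\<in>Poly_Mapping.keys f. Poly_Mapping.single m (Poly_Mapping.lookup f m)) k"
    by (simp add: lookup_sum lookup_single when_def in_keys_iff)
qed

lemma push_cong: "(\<And>m. m \<in> Poly_Mapping.keys f \<Longrightarrow> g m = h m) \<Longrightarrow> push g f = push h f"
  by (auto simp: push_def intro: sum.cong)

lemma push_ident: "(\<And>m. m \<in> Poly_Mapping.keys f \<Longrightarrow> g m = m) \<Longrightarrow> push g f = f"
  using poly_mapping_expand[of f] push_cong[of f g "\<lambda>m. m"] by (simp add: push_def)

lemma push_push: "push g (push h f) = push (\<lambda>m. g (h m)) f"
  by (simp add: push_def[of h] push_sum) (simp add: push_def)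

lemma keys_push: "Poly_Mapping.keys (push g f) \<subseteq> g ` Poly_Mapping.keys f"
  unfolding push_def using keys_sum[of _ "Poly_Mapping.keys f"] by (fastforce split: if_splits)

lemma push_mult:
  fixes f h :: "'a::monoid_add \<Rightarrow>\<^sub>0 'c::semiring_0"
  assumes "\<And>a b. g (a + b) = g a + g b"
  shows "push g (f * h) = push g f * push g h"
proof -
  have "push g (f * h) = (\<Sum>a\<in>Poly_Mapping.keys f. \<Sum>b\<in>Poly_Mapping.keys h.
      push g (Poly_Mapping.single a (Poly_Mapping.lookup f a) * Poly_Mapping.single b (Poly_Mapping.lookup h b)))"
    by (subst poly_mapping_expand[of f], subst poly_mapping_expand[of h])
      (simp add: sum_product push_sum)
  also have "\<dots> = push g f * push g h"
    by (simp add: mult_single assms push_def[of g f] push_def[of g h] sum_product)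
  finally show ?thesis .
qed

section \<open>Monomials and ideals of the polynomial ring\<close>

abbreviation monom_of :: "('v \<Rightarrow>\<^sub>0 nat) \<Rightarrow> 'v cpoly" where
  "monom_of m \<equiv> Poly_Mapping.single m 1"

definition mons :: "'v set \<Rightarrow> ('v \<Rightarrow>\<^sub>0 nat) set" where
  "mons V = {m. Poly_Mapping.keys m \<subseteq> V}"

lemma mons_zero [simp]: "0 \<in> mons V"
  by (simp add: mons_def)

lemma mons_add: "a \<in> mons V \<Longrightarrow> b \<in> mons V \<Longrightarrow> a + b \<in> mons V"
  using keys_add[of a b] by (auto simp: mons_def)

lemma mons_sum: "(\<And>i. i \<in> I \<Longrightarrow> f i \<in> mons V) \<Longrightarrow> sum f I \<in> mons V"
  by (induction I rule: infinite_finite_induct) (auto simp: mons_add)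

lemma mons_single: "v \<in> V \<Longrightarrow> Poly_Mapping.single v k \<in> mons V"
  by (auto simp: mons_def)

lemma carrier_poly_ring: "f \<in> carrier (poly_ring V) \<longleftrightarrow> Poly_Mapping.keys f \<subseteq> mons V"
  by (auto simp: poly_ring_def mons_def)

lemma monom_of_carrier: "m \<in> mons V \<Longrightarrow> Poly_Mapping.single m c \<in> carrier (poly_ring V)"
  by (auto simp: carrier_poly_ring)

lemma poly_ring_ops [simp]:
  "mult (poly_ring V) = (*)" "one (poly_ring V) = 1" "zero (poly_ring V) = 0" "add (poly_ring V) = (+)"
  by (simp_all add: poly_ring_def)

lemma poly_ring_uminus:
  assumes "f \<in> carrier (poly_ring V)"
  shows "\<ominus>\<^bsub>poly_ring V\<^esub> f = - f"
proof -
  interpret cring "poly_ring V" by (rule cring_poly_ring)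
  have "- f \<in> carrier (poly_ring V)" using assms by (simp add: carrier_poly_ring)
  then show ?thesis using assms minus_equality[of "-f" f] by simp
qed

lemma poly_ring_minus:
  "f \<in> carrier (poly_ring V) \<Longrightarrow> g \<in> carrier (poly_ring V) \<Longrightarrow> f \<ominus>\<^bsub>poly_ring V\<^esub> g = f - g"
  by (simp add: a_minus_def poly_ring_uminus)

text \<open>Turns the HOL-Algebra ideal axioms into closure under the type class operations, so that
  congruences modulo an ideal can be computed by ordinary ring arithmetic.\<close>

lemma ideal_poly_ring_closed:
  assumes "ideal I (poly_ring V)"
  shows "0 \<in> I" "f \<in> I \<Longrightarrow> g \<in> I \<Longrightarrow> f + g \<in> I" "f \<in> I \<Longrightarrow> - f \<in> I"
    "f \<in> I \<Longrightarrow> h \<in> carrier (poly_ring V) \<Longrightarrow> h * f \<in> I"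
    "(\<And>i. i \<in> J \<Longrightarrow> F i \<in> I) \<Longrightarrow> sum F J \<in> I"
proof -
  interpret ideal I "poly_ring V" by fact
  show z: "0 \<in> I" using additive_subgroup.zero_closed[OF is_additive_subgroup] by simp
  show add: "f + g \<in> I" if "f \<in> I" "g \<in> I" for f g
    using additive_subgroup.a_closed[OF is_additive_subgroup that] by simp
  show "- f \<in> I" if "f \<in> I"
    using additive_subgroup.a_inv_closed[OF is_additive_subgroup that] that
    by (simp add: poly_ring_uminus a_Hcarr)
  show "h * f \<in> I" if "f \<in> I" "h \<in> carrier (poly_ring V)"
    using I_l_closed[OF that] by simp
  show "sum F J \<in> I" if "\<And>i. i \<in> J \<Longrightarrow> F i \<in> I"
    using that by (induction J rule: infinite_finite_induct) (auto simp: z add)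
qed

text \<open>Modulo \<open>I\<close> every monomial may be replaced by a chosen representative of its fibre under \<open>\<pi>\<close>.\<close>

lemma toric_kernel:
  assumes I: "ideal I (poly_ring V)"
    and fib: "\<And>u u'. u \<in> mons V \<Longrightarrow> u' \<in> mons V \<Longrightarrow> \<pi> u = \<pi> u' \<Longrightarrow> monom_of u - monom_of u' \<in> I"
    and f: "f \<in> carrier (poly_ring V)" "push \<pi> f = 0"
  shows "f \<in> I"
proof -
  define s where "s = inv_into (mons V) \<pi>"
  let ?K = "Poly_Mapping.keys f" and ?c = "Poly_Mapping.lookup f"
  have K: "?K \<subseteq> mons V" using f by (simp add: carrier_poly_ring)
  have *: "monom_of m - monom_of (s (\<pi> m)) \<in> I" if "m \<in> ?K" for m
  proof (rule fib)
    show "m \<in> mons V" using that K by auto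
    then show "s (\<pi> m) \<in> mons V" "\<pi> m = \<pi> (s (\<pi> m))"
      by (auto simp: s_def inv_into_into f_inv_into_f)
  qed
  \<comment> \<open>This combination of fibre binomials is \<open>f - push s (push \<pi> f)\<close>,
    whose second term vanishes by assumption.\<close>
  have "(\<Sum>m\<in>?K. Poly_Mapping.single 0 (?c m) * (monom_of m - monom_of (s (\<pi> m)))) \<in> I"
    using * by (intro ideal_poly_ring_closed(4,5)[OF I] monom_of_carrier) auto
  also have "(\<Sum>m\<in>?K. Poly_Mapping.single 0 (?c m) * (monom_of m - monom_of (s (\<pi> m))))
      = (\<Sum>m\<in>?K. Poly_Mapping.single m (?c m)) - push s (push \<pi> f)"
    by (simp add: right_diff_distrib mult_single sum_subtractf push_push push_def[of "\<lambda>m. s (\<pi> m)"])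
  also have "(\<Sum>m\<in>?K. Poly_Mapping.single m (?c m)) = f"
    by (rule poly_mapping_expand[symmetric])
  finally show ?thesis by (simp add: f)
qed

text \<open>The first isomorphism theorem for \<open>push \<pi>\<close>. Additivity of
  \<open>\<pi>\<close> makes it a ring homomorphism, \<open>car\<close> identifies its image with
  \<open>C\<close>, and by \<open>toric_kernel\<close> its kernel is generated by \<open>S\<close>
  once the generated ideal contains the binomials of all fibres.\<close>

lemma toric_iso:
  fixes \<pi> :: "('v \<Rightarrow>\<^sub>0 nat) \<Rightarrow> 'w \<Rightarrow>\<^sub>0 nat"
  assumes pi0: "\<pi> 0 = 0" and pi_add: "\<And>a b. \<pi> (a + b) = \<pi> a + \<pi> b"
    and S: "S \<subseteq> carrier (poly_ring V)" "\<And>f. f \<in> S \<Longrightarrow> push \<pi> f = 0"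
    and fib: "\<And>u u'. u \<in> mons V \<Longrightarrow> u' \<in> mons V \<Longrightarrow> \<pi> u = \<pi> u' \<Longrightarrow>
      monom_of u - monom_of u' \<in> genideal (poly_ring V) S"
    and car: "\<And>f. f \<in> C \<longleftrightarrow> Poly_Mapping.keys f \<subseteq> \<pi> ` mons V"
  shows "calg_iso ((poly_ring W)\<lparr>carrier := C\<rparr>) Const
    (poly_ring V Quot genideal (poly_ring V) S)
    (\<lambda>c. genideal (poly_ring V) S +>\<^bsub>poly_ring V\<^esub> Const c)"
proof -
  let ?R = "poly_ring V" and ?T = "(poly_ring W)\<lparr>carrier := C\<rparr>"
  let ?I = "genideal ?R S"
  interpret R: cring ?R by (rule cring_poly_ring)
  have I: "ideal ?I ?R" by (rule R.genideal_ideal[OF S(1)])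
  have img: "push \<pi> ` carrier ?R = C"
  proof (intro equalityI subsetI)
    fix f assume "f \<in> push \<pi> ` carrier ?R"
    then show "f \<in> C" using keys_push by (fastforce simp: car carrier_poly_ring)
  next
    fix f assume "f \<in> C"
    then have K: "Poly_Mapping.keys f \<subseteq> \<pi> ` mons V" by (simp add: car)
    \<comment> \<open>A set-theoretic section of \<open>\<pi>\<close> suffices to lift
      \<open>f\<close>, since \<open>push\<close> is linear along any map of exponents; additivity
      matters only for products.\<close>
    define s where "s = inv_into (mons V) \<pi>"
    have "push \<pi> (push s f) = f"
      unfolding push_push using K by (intro push_ident) (auto simp: s_def f_inv_into_f)
    moreover have "s w \<in> mons V" if "w \<in> Poly_Mapping.keys f" for w
      using K that by (auto simp: s_def intro!: inv_into_into)
    then have "push s f \<in> carrier ?R"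
      using keys_push[of s f] by (auto simp: carrier_poly_ring)
    ultimately show "f \<in> push \<pi> ` carrier ?R" by (metis imageI)
  qed
  have push_one: "push \<pi> 1 = 1"
    by (simp add: single_one[symmetric] pi0 del: single_one)
  \<comment> \<open>\<open>C\<close> gets its ring structure as the image of a homomorphism into the
    full polynomial ring.\<close>
  have "push \<pi> \<in> ring_hom ?R (poly_ring UNIV)"
    by (auto simp: ring_hom_def push_add push_mult pi_add push_one carrier_poly_ring mons_def)
  from R.ring_hom_imp_img_ring[OF this] have T: "ring ?T"
    by (simp add: img) (simp add: poly_ring_def)
  have hom: "ring_hom_ring ?R ?T (push \<pi>)"
  proof (rule ring_hom_ringI[OF R.ring_axioms T])
    show "push \<pi> f \<in> carrier ?T" if "f \<in> carrier ?R" for f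
      using imageI[OF that, of "push \<pi>"] img by simp
    show "push \<pi> (f \<otimes>\<^bsub>?R\<^esub> g) = push \<pi> f \<otimes>\<^bsub>?T\<^esub> push \<pi> g" for f g
      by (simp add: push_mult[OF pi_add])
    show "push \<pi> (f \<oplus>\<^bsub>?R\<^esub> g) = push \<pi> f \<oplus>\<^bsub>?T\<^esub> push \<pi> g" for f g
      by (simp add: push_add)
    show "push \<pi> \<one>\<^bsub>?R\<^esub> = \<one>\<^bsub>?T\<^esub>"
      by (simp add: push_one)
  qed
  have ker: "a_kernel ?R ?T (push \<pi>) = ?I"
  proof (intro equalityI subsetI)
    fix f assume "f \<in> a_kernel ?R ?T (push \<pi>)"
    then show "f \<in> ?I"
      by (intro toric_kernel[OF I fib]) (auto simp: a_kernel_def' )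
  next
    have "S \<subseteq> a_kernel ?R ?T (push \<pi>)" using S by (auto simp: a_kernel_def')
    then have "?I \<subseteq> a_kernel ?R ?T (push \<pi>)"
      using ring_hom_ring.kernel_is_ideal[OF hom] by (intro R.genideal_minimal)
    then show "f \<in> a_kernel ?R ?T (push \<pi>)" if "f \<in> ?I" for f using that by blast
  qed
  let ?\<psi> = "\<lambda>X. the_elem (push \<pi> ` X)"
  have iso: "?\<psi> \<in> ring_iso (?R Quot ?I) ?T"
    using ring_hom_ring.FactRing_iso_set[OF hom] img by (simp add: ker)
  have Q: "ring (?R Quot ?I)" by (rule ideal.quotient_is_ring[OF I])
  \<comment> \<open>The isomorphism \<open>?\<psi>\<close> runs from the quotient to
    \<open>?T\<close>, opposite to the goal. Its inverse respects constants because
    \<open>?\<psi>\<close> is injective and maps the coset of \<open>Const c\<close> to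
    \<open>Const c\<close>.\<close>
  have "inv_into (carrier (?R Quot ?I)) ?\<psi> (Const c) = ?I +>\<^bsub>?R\<^esub> Const c" for c
  proof -
    have c: "Const c \<in> carrier ?R" by (simp add: Const_def monom_of_carrier)
    have X: "?I +>\<^bsub>?R\<^esub> Const c \<in> carrier (?R Quot ?I)"
      using c by (auto simp: FactRing_def A_RCOSETS_def')
    have "push \<pi> ` (?I +>\<^bsub>?R\<^esub> Const c) = {Const c}"
    proof -
      have "push \<pi> (g + Const c) = Const c" if "g \<in> ?I" for g
        using that ker by (auto simp: a_kernel_def' push_add Const_def pi0)
      moreover have "0 \<in> ?I" by (rule ideal_poly_ring_closed(1)[OF I])
      ultimately show ?thesis by (force simp: a_r_coset_def' Const_def pi0)
    qed
    then have "?\<psi> (?I +>\<^bsub>?R\<^esub> Const c) = Const c" by simp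
    moreover have "inj_on ?\<psi> (carrier (?R Quot ?I))"
      using iso by (auto simp: ring_iso_def bij_betw_def)
    ultimately show ?thesis using X by (metis (no_types, lifting) inv_into_f_f)
  qed
  then show ?thesis
    unfolding calg_iso_def using ring_iso_set_sym[OF Q iso] by blast
qed


section \<open>Torus invariants and circulations\<close>

definition character :: "('q, 'p) pre_digraph \<Rightarrow> ('q \<Rightarrow> complex) \<Rightarrow> ('p \<Rightarrow>\<^sub>0 nat) \<Rightarrow> complex" where
  "character Q \<mu> e = (\<Prod>p\<in>Poly_Mapping.keys e.
     (inverse (\<mu> (tail Q p)) * \<mu> (head Q p)) ^ Poly_Mapping.lookup e p)"

lemma prod_single_power:
  "(\<Prod>p\<in>A. Poly_Mapping.single (Poly_Mapping.single p (1::nat)) (c p) ^ k p)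
    = Poly_Mapping.single (\<Sum>p\<in>A. Poly_Mapping.single p (k p)) (\<Prod>p\<in>A. c p ^ k p :: complex)"
proof -
  have pow: "Poly_Mapping.single (Poly_Mapping.single p (1::nat)) x ^ j
      = Poly_Mapping.single (Poly_Mapping.single p j) (x ^ j)" for p and x :: complex and j
    by (induction j) (simp_all add: mult_single single_add[symmetric])
  show ?thesis
    by (induction A rule: infinite_finite_induct) (simp_all add: pow mult_single del: One_nat_def)
qed

text \<open>Each arrow is an eigenvector of \<open>\<mu>\<close>, hence so is each monomial, with
  eigenvalue \<open>character Q \<mu> e\<close>. Invariance can therefore be tested one monomial at
  a time.\<close>

lemma torus_act_eq:
  "torus_act Q \<mu> f = (\<Sum>e\<in>Poly_Mapping.keys f.
     Poly_Mapping.single e (Poly_Mapping.lookup f e * character Q \<mu> e))"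
proof -
  have "Const (inverse (\<mu> (tail Q p))) * Var p * Const (\<mu> (head Q p))
      = Poly_Mapping.single (Poly_Mapping.single p 1) (inverse (\<mu> (tail Q p)) * \<mu> (head Q p))" for p
    by (simp add: Const_def Var_def mult_single)
  then show ?thesis
    unfolding torus_act_def poly_subst_def character_def
    by (simp add: prod_single_power poly_mapping_expand[symmetric] Const_def mult_single del: single_one One_nat_def)
qed

lemma lookup_torus_act:
  "Poly_Mapping.lookup (torus_act Q \<mu> f) e = Poly_Mapping.lookup f e * character Q \<mu> e"
  by (simp add: torus_act_eq lookup_sum lookup_single when_def in_keys_iff)

lemma torus_act_eq_iff:
  "torus_act Q \<mu> f = f \<longleftrightarrow> (\<forall>e\<in>Poly_Mapping.keys f. character Q \<mu> e = 1)"
  by (auto simp: poly_mapping_eq_iff fun_eq_iff lookup_torus_act in_keys_iff)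

definition circulations :: "('q, 'p) pre_digraph \<Rightarrow> ('p \<Rightarrow>\<^sub>0 nat) set" where
  "circulations Q = {e \<in> mons (arcs Q). \<forall>q\<in>verts Q.
     (\<Sum>p\<in>in_arcs Q q. Poly_Mapping.lookup e p) = (\<Sum>p\<in>out_arcs Q q. Poly_Mapping.lookup e p)}"

text \<open>Arrows are grouped by head in the numerator and by tail in the denominator, so that
  \<open>\<mu> q\<close> occurs with the inflow and the outflow at \<open>q\<close> as
  exponents.\<close>

lemma (in fin_digraph) character_eq:
  assumes e: "e \<in> mons (arcs G)" and \<mu>: "\<mu> \<in> torus G"
  shows "character G \<mu> e = (\<Prod>q\<in>verts G. \<mu> q ^ (\<Sum>p\<in>in_arcs G q. Poly_Mapping.lookup e p))
    / (\<Prod>q\<in>verts G. \<mu> q ^ (\<Sum>p\<in>out_arcs G q. Poly_Mapping.lookup e p))"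
proof -
  let ?e = "Poly_Mapping.lookup e"
  have "(\<Prod>p\<in>arcs G. \<mu> (head G p) ^ ?e p)
      = (\<Prod>q\<in>verts G. \<Prod>p\<in>{p \<in> arcs G. head G p = q}. \<mu> (head G p) ^ ?e p)"
    by (intro prod.group[symmetric]) auto
  also have "\<dots> = (\<Prod>q\<in>verts G. \<mu> q ^ (\<Sum>p\<in>in_arcs G q. ?e p))"
    by (intro prod.cong) (auto simp: in_arcs_def power_sum)
  finally have 1: "(\<Prod>p\<in>arcs G. \<mu> (head G p) ^ ?e p) = \<dots>" .
  have "(\<Prod>p\<in>arcs G. \<mu> (tail G p) ^ ?e p)
      = (\<Prod>q\<in>verts G. \<Prod>p\<in>{p \<in> arcs G. tail G p = q}. \<mu> (tail G p) ^ ?e p)"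
    by (intro prod.group[symmetric]) auto
  also have "\<dots> = (\<Prod>q\<in>verts G. \<mu> q ^ (\<Sum>p\<in>out_arcs G q. ?e p))"
    by (intro prod.cong) (auto simp: out_arcs_def power_sum)
  finally have 2: "(\<Prod>p\<in>arcs G. \<mu> (tail G p) ^ ?e p) = \<dots>" .
  have "character G \<mu> e = (\<Prod>p\<in>arcs G. (inverse (\<mu> (tail G p)) * \<mu> (head G p)) ^ ?e p)"
    unfolding character_def using e
    by (intro prod.mono_neutral_left) (auto simp: mons_def in_keys_iff)
  also have "\<dots> = (\<Prod>p\<in>arcs G. \<mu> (head G p) ^ ?e p) / (\<Prod>p\<in>arcs G. \<mu> (tail G p) ^ ?e p)"
    by (simp add: prod_dividef[symmetric] power_mult_distrib field_simps)
  finally show ?thesis by (simp add: 1 2)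
qed

lemma (in fin_digraph) character_trivial_iff:
  assumes e: "e \<in> mons (arcs G)"
  shows "(\<forall>\<mu>\<in>torus G. character G \<mu> e = 1) \<longleftrightarrow> e \<in> circulations G"
proof
  let ?i = "\<lambda>q. \<Sum>p\<in>in_arcs G q. Poly_Mapping.lookup e p"
  let ?o = "\<lambda>q. \<Sum>p\<in>out_arcs G q. Poly_Mapping.lookup e p"
  assume triv: "\<forall>\<mu>\<in>torus G. character G \<mu> e = 1"
  have "?i q = ?o q" if q: "q \<in> verts G" for q
  proof -
    \<comment> \<open>2 is not a root of unity, so this single point of the torus compares inflow
      and outflow at \<open>q\<close>.\<close>
    define \<mu> :: "'a \<Rightarrow> complex" where "\<mu> = (\<lambda>v\<in>verts G. if v = q then 2 else 1)"
    have \<mu>: "\<mu> \<in> torus G" by (auto simp: \<mu>_def torus_def)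
    have P: "(\<Prod>v\<in>verts G. \<mu> v ^ k v) = 2 ^ k q" for k :: "'a \<Rightarrow> nat"
      using q by (subst prod.remove[of _ q]) (auto simp: \<mu>_def)
    have "(2::complex) ^ ?i q / 2 ^ ?o q = 1"
      using triv \<mu> character_eq[OF e \<mu>] by (simp add: P)
    then have "(2::complex) ^ ?i q = 2 ^ ?o q" by simp
    then have "complex_of_nat (2 ^ ?i q) = complex_of_nat (2 ^ ?o q)" by simp
    then have "(2::nat) ^ ?i q = 2 ^ ?o q" by (simp only: of_nat_eq_iff)
    then show ?thesis by simp
  qed
  then show "e \<in> circulations G" using e by (simp add: circulations_def)
next
  assume "e \<in> circulations G"
  then show "\<forall>\<mu>\<in>torus G. character G \<mu> e = 1"
    using e by (auto simp: character_eq circulations_def torus_def PiE_iff)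
qed

lemma (in fin_digraph) carrier_invariant_ring:
  "f \<in> carrier (invariant_ring G) \<longleftrightarrow> Poly_Mapping.keys f \<subseteq> circulations G"
proof -
  have "circulations G \<subseteq> mons (arcs G)" by (auto simp: circulations_def)
  then show ?thesis
    using character_trivial_iff
    by (simp add: invariant_ring_def carrier_poly_ring torus_act_eq_iff) (meson in_mono subset_iff)
qed


section \<open>Monomials in the cycles of the quiver\<close>

lemma sum_when_inj:
  assumes "finite A" "a \<in> A" "\<And>b. b \<in> A \<Longrightarrow> f b = f a \<longleftrightarrow> b = a"
  shows "(\<Sum>b\<in>A. (c b when f b = f a)) = (c a :: nat)"
proof -
  have "(\<Sum>b\<in>A. (c b when f b = f a)) = (\<Sum>b\<in>A. if b = a then c b else 0)"
    using assms(3) by (intro sum.cong) (auto simp: when_def)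
  then show ?thesis using assms by simp
qed

lemma sum_when_neq:
  assumes "\<And>b. b \<in> A \<Longrightarrow> f b \<noteq> p"
  shows "(\<Sum>b\<in>A. (c b when f b = p)) = (0 :: nat)"
  using assms by (intro sum.neutral) (auto simp: when_def)

text \<open>Separates the combinatorics from the labelling: what enters is the weakly increasing
  sequence of tails \<open>l h\<close> of the arrows \<open>K h\<close>, and the fact that
  differently named arrows, or variables, differ. For \<open>n = 1\<close> there are no two-cycles
  \<open>zv\<close>.\<close>

locale cycle_monomials =
  fixes n m :: nat and l :: "nat \<Rightarrow> nat"
    and K cw acw :: "nat \<Rightarrow> 'p" and zx zy zv :: "nat \<Rightarrow> 'z"
  assumes n_pos: "1 \<le> n"
    and l_mono: "\<And>i j. i \<le> j \<Longrightarrow> j \<le> m \<Longrightarrow> l i \<le> l j"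
    and l_range: "\<And>h. h \<le> m \<Longrightarrow> 1 \<le> l h \<and> l h \<le> n"
    and inj_K: "\<And>g h. g \<le> m \<Longrightarrow> h \<le> m \<Longrightarrow> K g = K h \<longleftrightarrow> g = h"
    and inj_cw: "\<And>v w. v \<in> {1..n} \<Longrightarrow> w \<in> {1..n} \<Longrightarrow> cw v = cw w \<longleftrightarrow> v = w"
    and inj_acw: "\<And>v w. v \<in> {1..n} \<Longrightarrow> w \<in> {1..n} \<Longrightarrow> acw v = acw w \<longleftrightarrow> v = w"
    and K_cw: "\<And>h v. h \<le> m \<Longrightarrow> v \<in> {1..n} \<Longrightarrow> K h \<noteq> cw v"
    and K_acw: "\<And>h v. h \<le> m \<Longrightarrow> v \<in> {1..n} \<Longrightarrow> K h \<noteq> acw v"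
    and cw_acw: "\<And>v w. v \<in> {1..n} \<Longrightarrow> w \<in> {1..n} \<Longrightarrow> cw v \<noteq> acw w"
    and inj_zx: "\<And>g h. g \<le> m \<Longrightarrow> h \<le> m \<Longrightarrow> zx g = zx h \<longleftrightarrow> g = h"
    and inj_zy: "\<And>g h. g \<le> m \<Longrightarrow> h \<le> m \<Longrightarrow> zy g = zy h \<longleftrightarrow> g = h"
    and inj_zv: "\<And>v w. v \<in> {1..<n} \<Longrightarrow> w \<in> {1..<n} \<Longrightarrow> zv v = zv w \<longleftrightarrow> v = w"
    and zx_zy: "\<And>g h. g \<le> m \<Longrightarrow> h \<le> m \<Longrightarrow> zx g \<noteq> zy h"
    and zx_zv: "\<And>h v. h \<le> m \<Longrightarrow> v \<in> {1..<n} \<Longrightarrow> zx h \<noteq> zv v"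
    and zy_zv: "\<And>h v. h \<le> m \<Longrightarrow> v \<in> {1..<n} \<Longrightarrow> zy h \<noteq> zv v"
begin

section \<open>The exponent map of the cycle substitution\<close>

definition Z :: "'z set" where
  "Z = zx ` {..m} \<union> zy ` {..m} \<union> zv ` {1..<n}"

definition arrows :: "'p set" where
  "arrows = K ` {..m} \<union> cw ` {1..n} \<union> acw ` {1..n}"

text \<open>The path \<open>C_{0l}\<close> enters the vertices \<open>n, n-1, ..., l\<close>, hence
  uses the clockwise arrow into \<open>v\<close> exactly when \<open>l \<le> v\<close>; the
  two-cycle \<open>zv v\<close> uses it as well. Symmetrically, \<open>acw_mult\<close> counts the
  paths \<open>A_{0l}\<close> entering \<open>1, ..., l\<close> and the two-cycle below
  \<open>v\<close>.\<close>

definition cw_mult :: "('z \<Rightarrow>\<^sub>0 nat) \<Rightarrow> nat \<Rightarrow> nat" where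
  "cw_mult u v = (\<Sum>h | h \<le> m \<and> l h \<le> v. Poly_Mapping.lookup u (zx h))
     + (if v < n then Poly_Mapping.lookup u (zv v) else 0)"

definition acw_mult :: "('z \<Rightarrow>\<^sub>0 nat) \<Rightarrow> nat \<Rightarrow> nat" where
  "acw_mult u v = (\<Sum>h | h \<le> m \<and> v \<le> l h. Poly_Mapping.lookup u (zy h))
     + (if 2 \<le> v then Poly_Mapping.lookup u (zv (v - 1)) else 0)"

text \<open>The exponent map of the substitution \<open>zx h \<mapsto> C\<^sub>0\<^sub>l k\<^sub>h\<close>, \<open>zy h \<mapsto> A\<^sub>0\<^sub>l k\<^sub>h\<close> with \<open>l = l h\<close>
  and \<open>zv v \<mapsto> c\<^sub>v\<^sub>+\<^sub>1\<^sub>,\<^sub>v a\<^sub>v\<^sub>,\<^sub>v\<^sub>+\<^sub>1\<close>, where \<open>cw v\<close> and \<open>acw v\<close> are the arrows with head \<open>v\<close>.\<close>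

definition \<pi> :: "('z \<Rightarrow>\<^sub>0 nat) \<Rightarrow> 'p \<Rightarrow>\<^sub>0 nat" where
  "\<pi> u = (\<Sum>h\<le>m. Poly_Mapping.single (K h)
        (Poly_Mapping.lookup u (zx h) + Poly_Mapping.lookup u (zy h)))
     + (\<Sum>v\<in>{1..n}. Poly_Mapping.single (cw v) (cw_mult u v))
     + (\<Sum>v\<in>{1..n}. Poly_Mapping.single (acw v) (acw_mult u v))"

lemma mult_zero: "cw_mult 0 v = 0" "acw_mult 0 v = 0"
  by (simp_all add: cw_mult_def acw_mult_def)

lemma mult_add:
  "cw_mult (a + b) v = cw_mult a v + cw_mult b v"
  "acw_mult (a + b) v = acw_mult a v + acw_mult b v"
  by (simp_all add: cw_mult_def acw_mult_def lookup_add sum.distrib)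

lemma \<pi>_zero: "\<pi> 0 = 0"
  by (simp add: \<pi>_def mult_zero)

lemma \<pi>_add: "\<pi> (a + b) = \<pi> a + \<pi> b"
  by (simp add: \<pi>_def mult_add lookup_add single_add sum.distrib algebra_simps)

lemma lookup_\<pi>:
  "Poly_Mapping.lookup (\<pi> u) p
    = (\<Sum>h\<le>m. (Poly_Mapping.lookup u (zx h) + Poly_Mapping.lookup u (zy h) when K h = p))
      + (\<Sum>v\<in>{1..n}. (cw_mult u v when cw v = p)) + (\<Sum>v\<in>{1..n}. (acw_mult u v when acw v = p))"
  by (simp only: \<pi>_def lookup_add lookup_sum lookup_single)

lemma lookup_\<pi>_K:
  assumes "h \<le> m"
  shows "Poly_Mapping.lookup (\<pi> u) (K h)
    = Poly_Mapping.lookup u (zx h) + Poly_Mapping.lookup u (zy h)"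
proof -
  have "(\<Sum>v\<in>{1..n}. (cw_mult u v when cw v = K h)) = 0"
    by (rule sum_when_neq) (metis K_cw[OF assms])
  moreover have "(\<Sum>v\<in>{1..n}. (acw_mult u v when acw v = K h)) = 0"
    by (rule sum_when_neq) (metis K_acw[OF assms])
  moreover have "(\<Sum>g\<le>m. (Poly_Mapping.lookup u (zx g) + Poly_Mapping.lookup u (zy g) when K g = K h))
      = Poly_Mapping.lookup u (zx h) + Poly_Mapping.lookup u (zy h)"
    by (rule sum_when_inj) (use assms inj_K in simp_all)
  ultimately show ?thesis by (simp only: lookup_\<pi> add_0_right)
qed

lemma lookup_\<pi>_cw:
  assumes "v \<in> {1..n}"
  shows "Poly_Mapping.lookup (\<pi> u) (cw v) = cw_mult u v"
proof -
  have "(\<Sum>g\<le>m. (Poly_Mapping.lookup u (zx g) + Poly_Mapping.lookup u (zy g) when K g = cw v)) = 0"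
    by (rule sum_when_neq) (metis K_cw[OF _ assms] atMost_iff)
  moreover have "(\<Sum>w\<in>{1..n}. (acw_mult u w when acw w = cw v)) = 0"
    by (rule sum_when_neq) (metis cw_acw[OF assms])
  moreover have "(\<Sum>w\<in>{1..n}. (cw_mult u w when cw w = cw v)) = cw_mult u v"
    by (rule sum_when_inj) (use assms inj_cw in simp_all)
  ultimately show ?thesis by (simp only: lookup_\<pi> add_0_left add_0_right)
qed

lemma lookup_\<pi>_acw:
  assumes "v \<in> {1..n}"
  shows "Poly_Mapping.lookup (\<pi> u) (acw v) = acw_mult u v"
proof -
  have "(\<Sum>g\<le>m. (Poly_Mapping.lookup u (zx g) + Poly_Mapping.lookup u (zy g) when K g = acw v)) = 0"
    by (rule sum_when_neq) (metis K_acw[OF _ assms] atMost_iff)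
  moreover have "(\<Sum>w\<in>{1..n}. (cw_mult u w when cw w = acw v)) = 0"
    by (rule sum_when_neq) (metis cw_acw[OF _ assms])
  moreover have "(\<Sum>w\<in>{1..n}. (acw_mult u w when acw w = acw v)) = acw_mult u v"
    by (rule sum_when_inj) (use assms inj_acw in simp_all)
  ultimately show ?thesis by (simp only: lookup_\<pi> add_0_left add_0_right)
qed

lemma keys_\<pi>: "\<pi> u \<in> mons arrows"
  unfolding \<pi>_def
  by (intro mons_add mons_sum mons_single) (auto simp: arrows_def)

lemma \<pi>_eqI:
  assumes "e \<in> mons arrows"
    and "\<And>h. h \<le> m \<Longrightarrow> Poly_Mapping.lookup u (zx h) + Poly_Mapping.lookup u (zy h) = Poly_Mapping.lookup e (K h)"
    and "\<And>v. v \<in> {1..n} \<Longrightarrow> cw_mult u v = Poly_Mapping.lookup e (cw v)"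
    and "\<And>v. v \<in> {1..n} \<Longrightarrow> acw_mult u v = Poly_Mapping.lookup e (acw v)"
  shows "\<pi> u = e"
proof (rule poly_mapping_eqI)
  fix p
  show "Poly_Mapping.lookup (\<pi> u) p = Poly_Mapping.lookup e p"
  proof (cases "p \<in> arrows")
    case True
    then show ?thesis
      using assms by (auto simp: arrows_def lookup_\<pi>_K lookup_\<pi>_cw lookup_\<pi>_acw)
  next
    case False
    then show ?thesis
      using keys_\<pi>[of u] assms(1) by (metis in_keys_iff mem_Collect_eq mons_def subset_iff)
  qed
qed

section \<open>Straightening \<open>x_i y_j\<close> to \<open>y_i W x_j\<close>\<close>

definition straightened :: "nat \<Rightarrow> nat \<Rightarrow> 'z \<Rightarrow>\<^sub>0 nat" where
  "straightened i j = Poly_Mapping.single (zy i) 1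
     + (\<Sum>v\<in>{l i..<l j}. Poly_Mapping.single (zv v) 1) + Poly_Mapping.single (zx j) 1"

lemma straightened_mons: "i < j \<Longrightarrow> j \<le> m \<Longrightarrow> straightened i j \<in> mons Z"
  unfolding straightened_def using l_range[of i] l_range[of j]
  by (intro mons_add mons_sum mons_single) (auto simp: Z_def)

lemma lookup_crossed:
  assumes "i < j" "j \<le> m"
  defines "a \<equiv> Poly_Mapping.single (zx i) 1 + Poly_Mapping.single (zy j) (1::nat)"
  shows "h \<le> m \<Longrightarrow> Poly_Mapping.lookup a (zx h) = of_bool (h = i)"
    "h \<le> m \<Longrightarrow> Poly_Mapping.lookup a (zy h) = of_bool (h = j)"
    "v \<in> {1..<n} \<Longrightarrow> Poly_Mapping.lookup a (zv v) = 0"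
proof -
  have im: "i \<le> m" using assms by simp
  have eq: "Poly_Mapping.lookup a z = (1 when zx i = z) + (1 when zy j = z)" for z
    by (simp add: a_def lookup_add lookup_single)
  show "Poly_Mapping.lookup a (zx h) = of_bool (h = i)" if "h \<le> m"
    using that inj_zx[OF im that] zx_zy[OF that \<open>j \<le> m\<close>] unfolding eq by (auto simp: when_def)
  show "Poly_Mapping.lookup a (zy h) = of_bool (h = j)" if "h \<le> m"
    using that inj_zy[OF \<open>j \<le> m\<close> that] zx_zy[OF im that] unfolding eq by (auto simp: when_def)
  show "Poly_Mapping.lookup a (zv v) = 0" if "v \<in> {1..<n}"
    using zx_zv[OF im that] zy_zv[OF \<open>j \<le> m\<close> that] unfolding eq by (auto simp: when_def)
qed

lemma lookup_straightened:
  assumes "i < j" "j \<le> m"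
  shows "h \<le> m \<Longrightarrow> Poly_Mapping.lookup (straightened i j) (zx h) = of_bool (h = j)"
    "h \<le> m \<Longrightarrow> Poly_Mapping.lookup (straightened i j) (zy h) = of_bool (h = i)"
    "v \<in> {1..<n} \<Longrightarrow> Poly_Mapping.lookup (straightened i j) (zv v) = of_bool (l i \<le> v \<and> v < l j)"
proof -
  have lr: "{l i..<l j} \<subseteq> {1..<n}"
    using assms l_range[of i] l_range[of j] by auto
  have 0: "(\<Sum>v\<in>{l i..<l j}. (1 when zv v = z)) = (0::nat)" if "\<And>v. v \<in> {1..<n} \<Longrightarrow> z \<noteq> zv v" for z
    by (rule sum_when_neq) (metis that lr subsetD)
  have eq: "Poly_Mapping.lookup (straightened i j) z
      = (1 when zy i = z) + (\<Sum>v\<in>{l i..<l j}. (1 when zv v = z)) + (1 when zx j = z)" for z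
    by (simp add: straightened_def lookup_add lookup_sum lookup_single)
  show "Poly_Mapping.lookup (straightened i j) (zx h) = of_bool (h = j)" if "h \<le> m"
    using that assms zx_zy[of h i] inj_zx[of j h] zx_zv[of h] unfolding eq
    by (subst 0) (auto simp: when_def)
  show "Poly_Mapping.lookup (straightened i j) (zy h) = of_bool (h = i)" if "h \<le> m"
    using that assms zx_zy[of j h] inj_zy[of i h] zy_zv[of h] unfolding eq
    by (subst 0) (auto simp: when_def)
  show "Poly_Mapping.lookup (straightened i j) (zv v) = of_bool (l i \<le> v \<and> v < l j)" if v: "v \<in> {1..<n}"
  proof -
    have "(\<Sum>w\<in>{l i..<l j}. (1 when zv w = zv v)) = (\<Sum>w\<in>{l i..<l j}. if w = v then 1 else (0::nat))"
      using inj_zv[OF _ v] lr by (intro sum.cong) (auto simp: when_def)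
    then show ?thesis
      using v assms zx_zv[of j v] zy_zv[of i v] unfolding eq by (auto simp: when_def)
  qed
qed

lemma sum_of_bool:
  assumes "i \<le> m"
  shows "(\<Sum>h | h \<le> m \<and> P h. of_bool (h = i)) = (of_bool (P i) :: nat)"
proof -
  have "(\<Sum>h | h \<le> m \<and> P h. of_bool (h = i)) = (\<Sum>h | h \<le> m \<and> P h. if h = i then 1 else (0::nat))"
    by (intro sum.cong) auto
  then show ?thesis using assms by (simp add: sum.delta)
qed

text \<open>As \<open>l i \<le> l j\<close>, the clockwise path to \<open>l i\<close> extends the
  one to \<open>l j\<close>, and the anticlockwise path to \<open>l j\<close> extends the one to
  \<open>l i\<close>. The two extensions consist of the same arrows as the two-cycles
  \<open>zv v\<close> for \<open>v\<close> from \<open>l i\<close> to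
  \<open>l j - 1\<close>.\<close>

lemma \<pi>_straightened:
  assumes ij: "i < j" "j \<le> m"
  shows "\<pi> (straightened i j) = \<pi> (Poly_Mapping.single (zx i) 1 + Poly_Mapping.single (zy j) 1)"
proof (rule \<pi>_eqI[OF keys_\<pi>])
  let ?a = "Poly_Mapping.single (zx i) 1 + Poly_Mapping.single (zy j) (1::nat)"
  have im: "i \<le> m" using ij by simp
  have l: "1 \<le> l i" "l i \<le> l j" "l j \<le> n"
    using ij l_range[of i] l_range[of j] l_mono[of i j] by auto
  show "Poly_Mapping.lookup (straightened i j) (zx h) + Poly_Mapping.lookup (straightened i j) (zy h)
      = Poly_Mapping.lookup (\<pi> ?a) (K h)" if "h \<le> m" for h
    using that by (simp only: lookup_\<pi>_K lookup_straightened[OF ij] lookup_crossed[OF ij] add.commute)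
  show "cw_mult (straightened i j) v = Poly_Mapping.lookup (\<pi> ?a) (cw v)" if v: "v \<in> {1..n}" for v
  proof -
    have "cw_mult (straightened i j) v = of_bool (l j \<le> v) + of_bool (v < n \<and> l i \<le> v \<and> v < l j)"
      using v ij by (simp add: cw_mult_def lookup_straightened[OF ij] sum_of_bool cong: conj_cong)
    moreover have "cw_mult ?a v = of_bool (l i \<le> v)"
      using v im by (simp add: cw_mult_def lookup_crossed[OF ij, simplified] sum_of_bool cong: conj_cong)
    ultimately show ?thesis using l v by (simp add: lookup_\<pi>_cw del: One_nat_def) auto
  qed
  show "acw_mult (straightened i j) v = Poly_Mapping.lookup (\<pi> ?a) (acw v)" if v: "v \<in> {1..n}" for v
  proof -
    have "v - 1 \<in> {1..<n}" if "2 \<le> v" using that v by auto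
    then have "acw_mult (straightened i j) v = of_bool (v \<le> l i) + of_bool (2 \<le> v \<and> l i \<le> v - 1 \<and> v - 1 < l j)"
      using v im by (simp add: acw_mult_def lookup_straightened[OF ij] sum_of_bool cong: conj_cong)
    moreover have "acw_mult ?a v = of_bool (v \<le> l j)"
      using v ij \<open>2 \<le> v \<Longrightarrow> v - 1 \<in> {1..<n}\<close>
      by (simp add: acw_mult_def lookup_crossed[OF ij, simplified] sum_of_bool cong: conj_cong)
    ultimately show ?thesis using l v by (simp add: lookup_\<pi>_acw del: One_nat_def) auto
  qed
qed

section \<open>Normal monomials and their uniqueness\<close>

abbreviation ex where "ex u h \<equiv> Poly_Mapping.lookup u (zx h)"
abbreviation ey where "ey u h \<equiv> Poly_Mapping.lookup u (zy h)"

definition normal :: "('z \<Rightarrow>\<^sub>0 nat) \<Rightarrow> bool" where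
  "normal u \<longleftrightarrow> (\<forall>i j. i < j \<and> j \<le> m \<longrightarrow> ex u i = 0 \<or> ey u j = 0)"

text \<open>If some y-variable occurs from \<open>h\<close> on, normality kills all x-exponents
  before \<open>h\<close>, so the tail already contains the whole x-total; otherwise the tail has no
  y-exponents. The minimum covers both cases and depends only on data visible in
  \<open>\<pi> u\<close>.\<close>

lemma normal_tail_sum:
  assumes "normal u" "h \<le> Suc m"
  shows "(\<Sum>g\<in>{h..m}. ex u g) = min (\<Sum>g\<le>m. ex u g) (\<Sum>g\<in>{h..m}. ex u g + ey u g)"
proof -
  have split: "(\<Sum>g\<le>m. ex u g) = (\<Sum>g<h. ex u g) + (\<Sum>g\<in>{h..m}. ex u g)"
  proof -
    have "{..m} = {..<h} \<union> {h..m}" using assms(2) by auto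
    then show ?thesis by (simp add: sum.union_disjoint ivl_disj_int)
  qed
  show ?thesis
  proof (cases "\<forall>g\<in>{h..m}. ey u g = 0")
    case True
    then show ?thesis by (simp add: split)
  next
    case False
    then obtain j where "h \<le> j" and "j \<le> m" and "ey u j \<noteq> 0" by auto
    have "ex u g = 0" if "g < h" for g
      using assms(1) \<open>h \<le> j\<close> \<open>j \<le> m\<close> \<open>ey u j \<noteq> 0\<close> that unfolding normal_def
      by (meson order_less_le_trans)
    then have "(\<Sum>g<h. ex u g) = 0" by simp
    then show ?thesis by (simp add: split sum.distrib)
  qed
qed

text \<open>Every path \<open>C_{0l}\<close> starts with \<open>c_{0n}\<close>, and no two-cycle
  uses it.\<close>

lemma cw_mult_n: "cw_mult u n = (\<Sum>g\<le>m. ex u g)"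
proof -
  have "{h. h \<le> m \<and> l h \<le> n} = {..m}" using l_range by auto
  then show ?thesis by (simp add: cw_mult_def)
qed

text \<open>Differences of consecutive tail sums recover the x-exponents from
  \<open>\<pi> u\<close>; the multiplicities of the \<open>K h\<close> then give the y-exponents,
  and those of the \<open>cw v\<close> the two-cycles.\<close>

lemma normal_unique:
  assumes u: "u \<in> mons Z" "normal u" and u': "u' \<in> mons Z" "normal u'"
    and eq: "\<pi> u = \<pi> u'"
  shows "u = u'"
proof -
  have k: "ex u h + ey u h = ex u' h + ey u' h" if "h \<le> m" for h
    using that eq lookup_\<pi>_K by metis
  have c: "cw_mult u v = cw_mult u' v" if "v \<in> {1..n}" for v
    using that eq lookup_\<pi>_cw by metis
  have t: "(\<Sum>g\<in>{h..m}. ex u g) = (\<Sum>g\<in>{h..m}. ex u' g)" if "h \<le> Suc m" for h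
  proof -
    have "(\<Sum>g\<in>{h..m}. ex u g + ey u g) = (\<Sum>g\<in>{h..m}. ex u' g + ey u' g)"
      by (intro sum.cong refl) (simp add: k)
    moreover have "(\<Sum>g\<le>m. ex u g) = (\<Sum>g\<le>m. ex u' g)"
      using c[of n] n_pos by (simp add: cw_mult_n)
    ultimately show ?thesis
      using normal_tail_sum[OF u(2) that] normal_tail_sum[OF u'(2) that] by simp
  qed
  have x: "ex u h = ex u' h" if "h \<le> m" for h
    using t[of h] t[of "Suc h"] that by (simp add: sum.atLeast_Suc_atMost)
  have y: "ey u h = ey u' h" if "h \<le> m" for h
    using k x that by (metis add_left_cancel)
  have v: "Poly_Mapping.lookup u (zv v) = Poly_Mapping.lookup u' (zv v)" if "v \<in> {1..<n}" for v
  proof -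
    have "(\<Sum>h | h \<le> m \<and> l h \<le> v. ex u h) = (\<Sum>h | h \<le> m \<and> l h \<le> v. ex u' h)"
      by (intro sum.cong) (auto simp: x)
    then show ?thesis using c[of v] that by (simp add: cw_mult_def)
  qed
  show ?thesis
  proof (rule poly_mapping_eqI)
    fix z
    show "Poly_Mapping.lookup u z = Poly_Mapping.lookup u' z"
    proof (cases "z \<in> Z")
      case True
      then show ?thesis using x y v by (auto simp: Z_def)
    next
      case False
      then have "z \<notin> Poly_Mapping.keys u" "z \<notin> Poly_Mapping.keys u'"
        using u(1) u'(1) by (auto simp: mons_def)
      then show ?thesis by (simp add: in_keys_iff)
    qed
  qed
qed

text \<open>Straightening moves \<open>zx\<close>-variables to the right, hence decreases this weight.\<close>

definition weight :: "('z \<Rightarrow>\<^sub>0 nat) \<Rightarrow> nat" where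
  "weight u = (\<Sum>h\<le>m. (m - h) * ex u h)"

lemma weight_add: "weight (a + b) = weight a + weight b"
  by (simp add: weight_def lookup_add sum.distrib distrib_left)

lemma sum_times_of_bool: "i \<le> m \<Longrightarrow> (\<Sum>h\<le>m. c h * of_bool (h = i)) = (c i :: nat)"
  by (simp add: of_bool_def if_distrib cong: if_cong)

lemma weight_straightened:
  assumes ij: "i < j" "j \<le> m"
  shows "weight (straightened i j) < weight (Poly_Mapping.single (zx i) 1 + Poly_Mapping.single (zy j) 1)"
proof -
  have "weight (straightened i j) = (\<Sum>h\<le>m. (m - h) * of_bool (h = j))"
    unfolding weight_def by (intro sum.cong refl) (simp only: lookup_straightened[OF ij] atMost_iff)
  moreover have "weight (Poly_Mapping.single (zx i) 1 + Poly_Mapping.single (zy j) 1)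
      = (\<Sum>h\<le>m. (m - h) * of_bool (h = i))"
    unfolding weight_def by (intro sum.cong refl) (simp only: lookup_crossed[OF ij] atMost_iff)
  ultimately show ?thesis
    using ij by (simp add: sum_times_of_bool)
qed

text \<open>Rewriting with the given binomials terminates because \<open>weight\<close> drops, and
  each step changes neither the class modulo \<open>I\<close> nor the value of
  \<open>\<pi>\<close>.\<close>

lemma reduce_to_normal:
  assumes I: "ideal I (poly_ring Z)"
    and gen: "\<And>i j. i < j \<Longrightarrow> j \<le> m \<Longrightarrow>
      monom_of (Poly_Mapping.single (zx i) 1 + Poly_Mapping.single (zy j) 1)
        - monom_of (straightened i j) \<in> I"
    and "u \<in> mons Z"
  shows "\<exists>w\<in>mons Z. normal w \<and> \<pi> w = \<pi> u \<and> monom_of u - monom_of w \<in> I"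
  using \<open>u \<in> mons Z\<close>
proof (induction "weight u" arbitrary: u rule: less_induct)
  case less
  show ?case
  proof (cases "normal u")
    case True
    then show ?thesis
      using less.prems ideal_poly_ring_closed(1)[OF I] by (intro bexI[of _ u]) auto
  next
    case False
    then obtain i j where ij: "i < j" "j \<le> m" and nz: "ex u i \<noteq> 0" "ey u j \<noteq> 0"
      by (auto simp: normal_def)
    define a where "a = Poly_Mapping.single (zx i) 1 + Poly_Mapping.single (zy j) (1::nat)"
    \<comment> \<open>This subtraction is truncated. That \<open>u = b + a\<close> holds because
      both variables divide the monomial and are distinct.\<close>
    define b where "b = u - a"
    have ne: "zx i \<noteq> zy j" using zx_zy[of i j] ij by simp
    have u: "u = b + a"
    proof (rule poly_mapping_eqI)
      fix z
      have "Poly_Mapping.lookup a z \<le> Poly_Mapping.lookup u z"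
        using nz ne by (auto simp: a_def lookup_add lookup_single when_def)
      then show "Poly_Mapping.lookup u z = Poly_Mapping.lookup (b + a) z"
        by (simp add: b_def lookup_add lookup_minus)
    qed
    have b: "b \<in> mons Z"
      using less.prems u by (auto simp: mons_def in_keys_iff lookup_add subset_iff)
    let ?u = "b + straightened i j"
    have u': "?u \<in> mons Z" by (intro mons_add b straightened_mons ij)
    have "weight ?u < weight u"
      using weight_straightened[OF ij] by (simp add: u weight_add a_def)
    from less.hyps[OF this u'] obtain w where
      w: "w \<in> mons Z" "normal w" "\<pi> w = \<pi> ?u" "monom_of ?u - monom_of w \<in> I" by blast
    have "monom_of b * (monom_of a - monom_of (straightened i j)) \<in> I"
      unfolding a_def by (intro ideal_poly_ring_closed(4)[OF I] gen ij monom_of_carrier b)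
    then have "monom_of u - monom_of ?u \<in> I"
      by (simp add: u right_diff_distrib mult_single)
    from ideal_poly_ring_closed(2)[OF I this w(4)] have "monom_of u - monom_of w \<in> I" by simp
    moreover have "\<pi> w = \<pi> u"
      using \<pi>_straightened[OF ij] by (simp add: w(3) u \<pi>_add a_def)
    ultimately show ?thesis using w by blast
  qed
qed

text \<open>By \<open>normal_unique\<close> both monomials reduce to the same normal one.\<close>

lemma fibre_binomial:
  assumes I: "ideal I (poly_ring Z)"
    and gen: "\<And>i j. i < j \<Longrightarrow> j \<le> m \<Longrightarrow>
      monom_of (Poly_Mapping.single (zx i) 1 + Poly_Mapping.single (zy j) 1)
        - monom_of (straightened i j) \<in> I"
    and u: "u \<in> mons Z" "u' \<in> mons Z" "\<pi> u = \<pi> u'"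
  shows "monom_of u - monom_of u' \<in> I"
proof -
  obtain w where w: "w \<in> mons Z" "normal w" "\<pi> w = \<pi> u" "monom_of u - monom_of w \<in> I"
    using reduce_to_normal[OF I gen u(1)] by blast
  obtain w' where w': "w' \<in> mons Z" "normal w'" "\<pi> w' = \<pi> u'" "monom_of u' - monom_of w' \<in> I"
    using reduce_to_normal[OF I gen u(2)] by blast
  have "w = w'" using normal_unique w w' u(3) by simp
  then show ?thesis
    using ideal_poly_ring_closed(2)[OF I w(4) ideal_poly_ring_closed(3)[OF I w'(4)]] by simp
qed

section \<open>The image of the exponent map: flow conservation\<close>

definition balanced :: "('p \<Rightarrow>\<^sub>0 nat) \<Rightarrow> bool" where
  "balanced e \<longleftrightarrow> (\<forall>v\<in>{1..n}.
     Poly_Mapping.lookup e (cw v) + Poly_Mapping.lookup e (acw v)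
     = (if 2 \<le> v then Poly_Mapping.lookup e (cw (v - 1)) else 0)
       + (if v < n then Poly_Mapping.lookup e (acw (v + 1)) else 0)
       + (\<Sum>h | h \<le> m \<and> l h = v. Poly_Mapping.lookup e (K h)))"

lemma sum_le_split:
  "(\<Sum>h | h \<le> m \<and> l h \<le> v. f h) = (\<Sum>h | h \<le> m \<and> Suc (l h) \<le> v. f h) + (\<Sum>h | h \<le> m \<and> l h = v. f h :: nat)"
  by (subst sum.union_disjoint[symmetric]) (auto intro!: sum.cong)

lemma sum_ge_split:
  "(\<Sum>h | h \<le> m \<and> v \<le> l h. f h) = (\<Sum>h | h \<le> m \<and> Suc v \<le> l h. f h) + (\<Sum>h | h \<le> m \<and> l h = v. f h :: nat)"
  by (subst sum.union_disjoint[symmetric]) (auto intro!: sum.cong)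

lemma \<pi>_balanced: "balanced (\<pi> u)"
  unfolding balanced_def
proof
  fix v assume v: "v \<in> {1..n}"
  have k: "(\<Sum>h | h \<le> m \<and> l h = v. Poly_Mapping.lookup (\<pi> u) (K h))
      = (\<Sum>h | h \<le> m \<and> l h = v. ex u h) + (\<Sum>h | h \<le> m \<and> l h = v. ey u h)"
    by (subst sum.distrib[symmetric], intro sum.cong) (auto simp: lookup_\<pi>_K)
  \<comment> \<open>Clockwise and anticlockwise flow are treated separately. Each is out of balance
    only by the two-cycles next to \<open>v\<close>, and these terms cancel when facts 1 and 2 are
    added.\<close>
  have 1: "cw_mult u v + (if 2 \<le> v then Poly_Mapping.lookup u (zv (v - 1)) else 0)
      = (if 2 \<le> v then cw_mult u (v - 1) else 0) + (if v < n then Poly_Mapping.lookup u (zv v) else 0)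
        + (\<Sum>h | h \<le> m \<and> l h = v. ex u h)"
  proof (cases "2 \<le> v")
    case True
    then have "{h. h \<le> m \<and> Suc (l h) \<le> v} = {h. h \<le> m \<and> l h \<le> v - 1}" "v - 1 < n"
      using v by auto
    then show ?thesis
      using True v \<open>v - 1 < n\<close> unfolding cw_mult_def sum_le_split[where v=v] by simp
  next
    case False
    then have none: "{h. h \<le> m \<and> Suc (l h) \<le> v} = {}" using l_range by force
    show ?thesis
      using False unfolding cw_mult_def sum_le_split[where v=v] none by simp
  qed
  have 2: "acw_mult u v + (if v < n then Poly_Mapping.lookup u (zv v) else 0)
      = (if v < n then acw_mult u (v + 1) else 0) + (if 2 \<le> v then Poly_Mapping.lookup u (zv (v - 1)) else 0)
        + (\<Sum>h | h \<le> m \<and> l h = v. ey u h)"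
  proof (cases "v < n")
    case True
    then show ?thesis
      using v unfolding acw_mult_def sum_ge_split[where v=v] by simp
  next
    case False
    then have none: "{h. h \<le> m \<and> Suc v \<le> l h} = {}" using v l_range by force
    show ?thesis
      using False unfolding acw_mult_def sum_ge_split[where v=v] none by simp
  qed
  have 3: "(if 2 \<le> v then Poly_Mapping.lookup (\<pi> u) (cw (v - 1)) else 0) = (if 2 \<le> v then cw_mult u (v - 1) else 0)"
  proof (cases "2 \<le> v")
    case True
    then have "v - 1 \<in> {1..n}" using v by auto
    then show ?thesis by (simp only: lookup_\<pi>_cw)
  qed simp
  have 4: "(if v < n then Poly_Mapping.lookup (\<pi> u) (acw (v + 1)) else 0) = (if v < n then acw_mult u (v + 1) else 0)"
    using lookup_\<pi>_acw[of "v + 1"] by auto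
  show "Poly_Mapping.lookup (\<pi> u) (cw v) + Poly_Mapping.lookup (\<pi> u) (acw v)
     = (if 2 \<le> v then Poly_Mapping.lookup (\<pi> u) (cw (v - 1)) else 0)
       + (if v < n then Poly_Mapping.lookup (\<pi> u) (acw (v + 1)) else 0)
       + (\<Sum>h | h \<le> m \<and> l h = v. Poly_Mapping.lookup (\<pi> u) (K h))"
    unfolding 3 4 k lookup_\<pi>_cw[OF v] lookup_\<pi>_acw[OF v] using 1 2 by linarith
qed

text \<open>Flow across a cut: \<open>{Suc v..n}\<close> is left through \<open>cw v\<close> and the
  \<open>K h\<close> with tail above \<open>v\<close>, and entered through \<open>cw n\<close> and
  \<open>acw (Suc v)\<close>. Downward induction from \<open>n\<close> adds one vertex at a time. At
  \<open>v = 0\<close> the clockwise exit is itself among the \<open>K h\<close>.\<close>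

lemma balanced_level:
  assumes "balanced e" "v \<le> n"
  shows "(if 1 \<le> v then Poly_Mapping.lookup e (cw v) else 0)
      + (\<Sum>h | h \<le> m \<and> Suc v \<le> l h. Poly_Mapping.lookup e (K h))
    = Poly_Mapping.lookup e (cw n) + (if v < n then Poly_Mapping.lookup e (acw (Suc v)) else 0)"
  using \<open>v \<le> n\<close>
proof (induction v rule: inc_induct)
  case base
  have none: "{h. h \<le> m \<and> Suc n \<le> l h} = {}" using l_range by force
  show ?case unfolding none using n_pos by simp
next
  case (step v)
  have "Suc v \<in> {1..n}" using step by simp
  with assms(1) have "Poly_Mapping.lookup e (cw (Suc v)) + Poly_Mapping.lookup e (acw (Suc v))
     = (if 2 \<le> Suc v then Poly_Mapping.lookup e (cw (Suc v - 1)) else 0)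
       + (if Suc v < n then Poly_Mapping.lookup e (acw (Suc v + 1)) else 0)
       + (\<Sum>h | h \<le> m \<and> l h = Suc v. Poly_Mapping.lookup e (K h))"
    unfolding balanced_def by blast
  with step show ?case
    unfolding sum_ge_split[where v="Suc v"] by (cases "v = 0"; cases "Suc v < n") simp_all
qed

text \<open>Since \<open>l\<close> is weakly increasing, tail sums over \<open>h\<close> double as
  sums over levels; \<open>g = Suc m\<close> is the case of an empty level set.\<close>

lemma upper_level_set: "\<exists>g\<le>Suc m. {h. h \<le> m \<and> v \<le> l h} = {g..m}"
proof (cases "\<exists>h\<le>m. v \<le> l h")
  case True
  define g where "g = (LEAST h. h \<le> m \<and> v \<le> l h)"
  have g: "g \<le> m" "v \<le> l g"
    using True LeastI_ex[of "\<lambda>h. h \<le> m \<and> v \<le> l h"] by (auto simp: g_def)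
  have "{h. h \<le> m \<and> v \<le> l h} = {g..m}"
  proof (intro equalityI subsetI)
    fix h assume "h \<in> {h. h \<le> m \<and> v \<le> l h}"
    then show "h \<in> {g..m}" using Least_le[of "\<lambda>h. h \<le> m \<and> v \<le> l h" h] by (simp add: g_def)
  next
    fix h assume "h \<in> {g..m}"
    then show "h \<in> {h. h \<le> m \<and> v \<le> l h}" using g l_mono[of g h] by simp
  qed
  then show ?thesis using g by (intro exI[of _ g]) simp
next
  case False
  then show ?thesis by (intro exI[of _ "Suc m"]) auto
qed

lemma lookup_combination:
  defines "u x y w \<equiv> (\<Sum>h\<le>m. Poly_Mapping.single (zx h) (x h)) + (\<Sum>h\<le>m. Poly_Mapping.single (zy h) (y h))
    + (\<Sum>v\<in>{1..<n}. Poly_Mapping.single (zv v) (w v :: nat))"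
  shows "u x y w \<in> mons Z"
    and "h \<le> m \<Longrightarrow> ex (u x y w) h = x h"
    and "h \<le> m \<Longrightarrow> ey (u x y w) h = y h"
    and "v \<in> {1..<n} \<Longrightarrow> Poly_Mapping.lookup (u x y w) (zv v) = w v"
proof -
  show "u x y w \<in> mons Z"
    unfolding u_def by (intro mons_add mons_sum mons_single) (auto simp: Z_def)
  have eq: "Poly_Mapping.lookup (u x y w) z = (\<Sum>h\<le>m. (x h when zx h = z))
      + (\<Sum>h\<le>m. (y h when zy h = z)) + (\<Sum>v\<in>{1..<n}. (w v when zv v = z))" for z
    by (simp only: u_def lookup_add lookup_sum lookup_single)
  show "ex (u x y w) h = x h" if h: "h \<le> m"
  proof -
    have "(\<Sum>g\<le>m. (y g when zy g = zx h)) = 0"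
      by (rule sum_when_neq) (metis atMost_iff zx_zy[OF h])
    moreover have "(\<Sum>v\<in>{1..<n}. (w v when zv v = zx h)) = 0"
      by (rule sum_when_neq) (metis zx_zv[OF h])
    moreover have "(\<Sum>g\<le>m. (x g when zx g = zx h)) = x h"
      by (rule sum_when_inj) (use h inj_zx in simp_all)
    ultimately show ?thesis by (simp only: eq add_0_right)
  qed
  show "ey (u x y w) h = y h" if h: "h \<le> m"
  proof -
    have "(\<Sum>g\<le>m. (x g when zx g = zy h)) = 0"
      by (rule sum_when_neq) (metis atMost_iff zx_zy[OF _ h])
    moreover have "(\<Sum>v\<in>{1..<n}. (w v when zv v = zy h)) = 0"
      by (rule sum_when_neq) (metis zy_zv[OF h])
    moreover have "(\<Sum>g\<le>m. (y g when zy g = zy h)) = y h"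
      by (rule sum_when_inj) (use h inj_zy in simp_all)
    ultimately show ?thesis by (simp only: eq add_0_right add_0_left)
  qed
  show "Poly_Mapping.lookup (u x y w) (zv v) = w v" if v: "v \<in> {1..<n}"
  proof -
    have "(\<Sum>g\<le>m. (x g when zx g = zv v)) = 0"
      by (rule sum_when_neq) (metis atMost_iff zx_zv[OF _ v])
    moreover have "(\<Sum>g\<le>m. (y g when zy g = zv v)) = 0"
      by (rule sum_when_neq) (metis atMost_iff zy_zv[OF _ v])
    moreover have "(\<Sum>q\<in>{1..<n}. (w q when zv q = zv v)) = w v"
      by (rule sum_when_inj) (use v inj_zv in simp_all)
    ultimately show ?thesis by (simp only: eq add_0_left)
  qed
qed

text \<open>The exponents are those forced by \<open>normal_tail_sum\<close>: \<open>X\<close> is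
  the required x-total, \<open>T h\<close> a tail sum of the multiplicities of the
  \<open>K h\<close>, and \<open>w v\<close> what is left of \<open>cw v\<close>. The multiplicities
  of \<open>acw\<close> then come out right by flow across cuts.\<close>

lemma \<pi>_surj:
  assumes e: "e \<in> mons arrows" and bal: "balanced e"
  shows "e \<in> \<pi> ` mons Z"
proof -
  let ?P = "\<lambda>v. Poly_Mapping.lookup e (cw v)" and ?R = "\<lambda>v. Poly_Mapping.lookup e (acw v)"
  let ?k = "\<lambda>h. Poly_Mapping.lookup e (K h)"
  define X where "X = ?P n"
  define T where "T h = (\<Sum>g\<in>{h..m}. ?k g)" for h
  \<comment> \<open>The difference is exact because \<open>T\<close> decreases in \<open>h\<close>;
    this makes the tail sums of \<open>x\<close> equal to \<open>min X (T h)\<close>.\<close>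
  define x where "x h = min X (T h) - min X (T (Suc h))" for h
  define y where "y h = ?k h - x h" for h
  define U where "U v = (\<Sum>h | h \<le> m \<and> Suc v \<le> l h. ?k h)" for v
  have T: "T h = ?k h + T (Suc h)" if "h \<le> m" for h
    using that by (simp add: T_def sum.atLeast_Suc_atMost)
  have x_le: "x h \<le> ?k h" if "h \<le> m" for h
    unfolding x_def T[OF that] by linarith
  have tail: "(\<Sum>g\<in>{h..m}. x g) = min X (T h)" if "h \<le> Suc m" for h
    using that
  proof (induction h rule: inc_induct)
    case base
    then show ?case by (simp add: T_def)
  next
    case (step h)
    then have "(\<Sum>g\<in>{h..m}. x g) = x h + min X (T (Suc h))"
      by (simp add: sum.atLeast_Suc_atMost)
    also have "\<dots> = min X (T h)" unfolding x_def using T[of h] step by simp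
    finally show ?case .
  qed
  have upper_x: "(\<Sum>h | h \<le> m \<and> Suc v \<le> l h. x h) = min X (U v)" for v
    using upper_level_set[of "Suc v"] tail by (auto simp: U_def T_def)
  have upper_y: "(\<Sum>h | h \<le> m \<and> Suc v \<le> l h. y h) = U v - X" for v
  proof -
    have "(\<Sum>h | h \<le> m \<and> Suc v \<le> l h. y h) = U v - min X (U v)"
      unfolding upper_x[symmetric] unfolding y_def U_def
      by (rule sum_subtractf_nat) (simp add: x_le)
    then show ?thesis by simp
  qed
  have level: "(if 1 \<le> v then ?P v else 0) + U v = X + (if v < n then ?R (Suc v) else 0)" if "v \<le> n" for v
    using balanced_level[OF bal that] by (simp add: U_def X_def)
  have all: "{h. h \<le> m \<and> Suc 0 \<le> l h} = {h. h \<le> m}"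
    using l_range by auto
  \<comment> \<open>The flow through \<open>cw n\<close> has to return to 0 through the arrows
    \<open>K h\<close>, so these can absorb all of \<open>X\<close>.\<close>
  have X_le: "X \<le> U 0" using level[of 0] n_pos by simp
  have total: "(\<Sum>h | h \<le> m. x h) = X"
    using upper_x[of 0] X_le unfolding all by simp
  have lower_x: "(\<Sum>h | h \<le> m \<and> l h \<le> v. x h) = X - U v" for v
  proof -
    have "(\<Sum>h | h \<le> m. x h)
        = (\<Sum>h | h \<le> m \<and> l h \<le> v. x h) + (\<Sum>h | h \<le> m \<and> Suc v \<le> l h. x h)"
      by (subst sum.union_disjoint[symmetric]) (auto intro!: sum.cong)
    then show ?thesis by (simp add: total upper_x)
  qed
  \<comment> \<open>\<open>X - U v\<close> x-cycles use \<open>cw v\<close>; \<open>level\<close>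
    shows that there are at most \<open>?P v\<close> of them for \<open>1 \<le> v\<close>.\<close>
  define w where "w v = ?P v - (X - U v)" for v
  define u where "u = (\<Sum>h\<le>m. Poly_Mapping.single (zx h) (x h)) + (\<Sum>h\<le>m. Poly_Mapping.single (zy h) (y h))
    + (\<Sum>v\<in>{1..<n}. Poly_Mapping.single (zv v) (w v))"
  note lookup_u = lookup_combination[where x=x and y=y and w=w, folded u_def]
  have "\<pi> u = e"
  proof (rule \<pi>_eqI[OF e])
    show "ex u h + ey u h = ?k h" if "h \<le> m" for h
      using that x_le[OF that] by (simp add: lookup_u y_def)
    show "cw_mult u v = ?P v" if v: "v \<in> {1..n}" for v
    proof -
      have "cw_mult u v = (X - U v) + (if v < n then w v else 0)"
        unfolding cw_mult_def using v lookup_u(4)[of v]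
        by (simp add: lower_x[symmetric] lookup_u(2))
      then show ?thesis using level[of v] v by (auto simp: w_def split: if_splits)
    qed
    show "acw_mult u v = ?R v" if v: "v \<in> {1..n}" for v
    proof -
      obtain q where q: "v = Suc q" "q < n" using v by (cases v) auto
      have "acw_mult u v = (U q - X) + (if 1 \<le> q then w q else 0)"
        unfolding acw_mult_def using q lookup_u(4)[of q]
        by (simp add: upper_y[symmetric] lookup_u(3))
      \<comment> \<open>At most one of \<open>U q - X\<close> and \<open>X - U q\<close> is nonzero,
        and \<open>level\<close> settles either case.\<close>
      then show ?thesis using level[of q] q X_le by (auto simp: w_def split: if_splits)
    qed
  qed
  then show ?thesis using lookup_u(1) by blast
qed

lemma image_\<pi>: "\<pi> ` mons Z = {e \<in> mons arrows. balanced e}"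
  using keys_\<pi> \<pi>_balanced \<pi>_surj by blast

end


section \<open>Riemenschneider duality\<close>

fun arrow_tail :: "arrow \<Rightarrow> nat" where
  "arrow_tail (Cw i) = i"
| "arrow_tail (Acw i) = i"
| "arrow_tail (Extra i j) = i"

text \<open>The bound \<open>b - 1\<close> is exclusive, which gives \<open>b - 2\<close> arrows at
  the vertex. The tails are weakly increasing along the list.\<close>

fun extra_arrows :: "nat \<Rightarrow> nat list \<Rightarrow> arrow list" where
  "extra_arrows i [] = []"
| "extra_arrows i (b # bs) = map (Extra i) [1..<b - 1] @ extra_arrows (Suc i) bs"

fun gaps :: "nat list \<Rightarrow> nat list" where
  "gaps (x # y # zs) = (y - x + 2) # gaps (y # zs)"
| "gaps _ = []"

lemma length_gaps: "length (gaps xs) = length xs - 1"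
  by (induction xs rule: gaps.induct) auto

lemma nth_gaps: "Suc t < length xs \<Longrightarrow> gaps xs ! t = xs ! Suc t - xs ! t + 2"
  by (induction xs arbitrary: t rule: gaps.induct) (auto simp: nth_Cons split: nat.splits)

lemma gaps_ge_2: "\<forall>b\<in>set (gaps xs). 2 \<le> b"
  by (induction xs rule: gaps.induct) auto

lemma gaps_replicate: "gaps (i # replicate k i @ zs) = replicate k 2 @ gaps (i # zs)"
  by (induction k) auto

lemma extra_arrows_tail_ge: "p \<in> set (extra_arrows i bs) \<Longrightarrow> i \<le> arrow_tail p"
  by (induction bs arbitrary: i) (fastforce dest: Suc_leD)+

text \<open>Prepending a 2 turns \<open>x / (x - 1)\<close> into
  \<open>2 - (x - 1) / x = (x + 1) / x\<close>, so it amounts to replacing \<open>x\<close> by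
  \<open>x + 1\<close>.\<close>

lemma hj_val_twos:
  assumes "ys \<noteq> []" "1 < x" "hj_val ys = x / (x - 1)"
  shows "hj_val (replicate k 2 @ ys) = (x + of_nat k) / (x + of_nat k - 1)"
proof (induction k)
  case (Suc k)
  have pos: "x + of_nat k - 1 > 0" "x + of_nat k > 0" using assms(2) by (auto intro: add_pos_nonneg)
  have "hj_val (replicate (Suc k) 2 @ ys) = 2 - 1 / hj_val (replicate k 2 @ ys)"
    using assms(1) by (simp add: hj_val_Cons)
  also have "\<dots> = (x + of_nat (Suc k)) / (x + of_nat (Suc k) - 1)"
    unfolding Suc.IH using pos by (simp add: field_simps)
  finally show ?case .
qed (simp add: assms)

text \<open>For \<open>i = 1\<close> the list under \<open>gaps\<close> consists of the tails \<open>l\<^sub>0, \<dots>, l\<^sub>m\<close>.\<close>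

lemma hj_val_gaps:
  assumes "bs \<noteq> []" "\<forall>b\<in>set bs. 2 \<le> b"
  shows "hj_val (gaps (i # map arrow_tail (extra_arrows i bs) @ [i + length bs - 1]))
    = hj_val bs / (hj_val bs - 1)"
  using assms
proof (induction bs arbitrary: i)
  case (Cons b bs)
  have b: "2 \<le> b" using Cons.prems by simp
  \<comment> \<open>The \<open>b - 2\<close> extra arrows at \<open>i\<close> repeat the tail
    \<open>i\<close>, and each repetition is a gap entry 2.\<close>
  have rep: "map arrow_tail (map (Extra i) [1..<b - 1]) = replicate (b - 2) i"
    by (simp add: map_replicate_const comp_def)
  show ?case
  proof (cases "bs = []")
    case True
    have "hj_val (replicate (b - 2) 2 @ [2]) = (2 + of_nat (b - 2)) / (2 + of_nat (b - 2) - 1)"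
      by (rule hj_val_twos) simp_all
    then show ?thesis using True b rep by (simp add: gaps_replicate of_nat_diff flip: numeral_2_eq_2)
  next
    case False
    define x where "x = hj_val bs"
    have x: "1 < x" unfolding x_def using False Cons.prems by (intro hj_val_gt_1) auto
    define zs where "zs = map arrow_tail (extra_arrows (Suc i) bs) @ [Suc i + length bs - 1]"
    obtain w ws where zs: "zs = w # ws" by (cases zs) (auto simp: zs_def)
    have "\<forall>z\<in>set zs. Suc i \<le> z"
      using extra_arrows_tail_ge[of _ "Suc i" bs] False by (auto simp: zs_def Suc_le_eq)
    then have w: "Suc i \<le> w" by (simp add: zs)
    have IH: "hj_val (gaps (Suc i # zs)) = x / (x - 1)"
      using Cons.IH[of "Suc i"] Cons.prems False by (simp add: zs_def x_def)
    \<comment> \<open>Starting one vertex earlier widens the first gap by one. The result has the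
      shape required by \<open>hj_val_twos\<close>, with parameter \<open>2 - 1 / x\<close>; the
      \<open>b - 2\<close> twos raise this to \<open>b - 1 / x\<close>.\<close>
    have "hj_val (gaps (i # zs)) = 1 + hj_val (gaps (Suc i # zs))"
      using w by (cases "gaps (w # ws)") (simp_all add: zs of_nat_diff)
    also have "\<dots> = (2 - 1 / x) / (2 - 1 / x - 1)"
      unfolding IH using x by (simp add: field_simps)
    finally have "hj_val (replicate (b - 2) 2 @ gaps (i # zs))
        = (2 - 1 / x + of_nat (b - 2)) / (2 - 1 / x + of_nat (b - 2) - 1)"
      using x by (intro hj_val_twos) (simp_all add: zs)
    moreover have "2 - 1 / x + of_nat (b - 2) = hj_val (b # bs)"
      using b False by (simp add: hj_val_Cons x_def of_nat_diff)
    ultimately show ?thesis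
      using rep by (simp add: gaps_replicate zs_def)
  qed
qed simp

definition k_arrows :: "nat list \<Rightarrow> arrow list" where
  "k_arrows \<alpha> = Cw 1 # extra_arrows 1 \<alpha> @ [Acw (length \<alpha>)]"

text \<open>Riemenschneider duality: for \<open>x = r/a\<close> the dual value
  \<open>x / (x - 1)\<close> is \<open>r/(r - a)\<close>.\<close>

lemma hj_expansion_dual:
  assumes "hj_expansion x \<alpha>"
  shows "hj_expansion (x / (x - 1)) (gaps (map arrow_tail (k_arrows \<alpha>)))"
proof -
  have "hj_val (gaps (1 # map arrow_tail (extra_arrows 1 \<alpha>) @ [1 + length \<alpha> - 1])) = x / (x - 1)"
    using assms hj_val_gaps[of \<alpha> 1] by (simp add: hj_expansion_def)
  moreover have "gaps (map arrow_tail (k_arrows \<alpha>)) \<noteq> []"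
    by (simp add: length_gaps k_arrows_def flip: length_greater_0_conv)
  ultimately show ?thesis
    by (simp add: hj_expansion_def gaps_ge_2 k_arrows_def)
qed

lemma set_extra_arrows:
  "set (extra_arrows i bs) = {Extra j q |j q. i \<le> j \<and> j < i + length bs \<and> 1 \<le> q \<and> q \<le> bs ! (j - i) - 2}"
proof (induction bs arbitrary: i)
  case (Cons b bs)
  have "set (extra_arrows i (b # bs)) = Extra i ` {1..<b - 1}
      \<union> {Extra j q |j q. Suc i \<le> j \<and> j < Suc i + length bs \<and> 1 \<le> q \<and> q \<le> bs ! (j - Suc i) - 2}"
    by (simp add: Cons.IH)
  also have "\<dots> = {Extra j q |j q. i \<le> j \<and> j < i + length (b # bs) \<and> 1 \<le> q \<and> q \<le> (b # bs) ! (j - i) - 2}"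
    (is "?A \<union> ?B = ?C")
  proof (intro equalityI subsetI)
    fix p assume "p \<in> ?A \<union> ?B"
    then show "p \<in> ?C"
    proof
      assume "p \<in> ?B"
      then obtain j q where "p = Extra j q" "Suc i \<le> j" "j < Suc i + length bs" "1 \<le> q"
        "q \<le> bs ! (j - Suc i) - 2" by blast
      moreover from this have "(b # bs) ! (j - i) = bs ! (j - Suc i)" by (simp add: nth_Cons')
      ultimately show ?thesis by auto
    qed auto
  next
    fix p assume "p \<in> ?C"
    then obtain j q where p: "p = Extra j q" "i \<le> j" "j < i + length (b # bs)" "1 \<le> q"
      "q \<le> (b # bs) ! (j - i) - 2" by blast
    show "p \<in> ?A \<union> ?B"
    proof (cases "j = i")
      case True
      then show ?thesis using p by auto
    next
      case False
      then have "(b # bs) ! (j - i) = bs ! (j - Suc i)" using p by (simp add: nth_Cons')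
      then show ?thesis using p False by auto
    qed
  qed
  finally show ?case .
qed auto

lemma distinct_extra_arrows: "distinct (extra_arrows i bs)"
  by (induction bs arbitrary: i) (auto simp: distinct_map inj_on_def set_extra_arrows)

lemma sorted_extra_arrows: "sorted (map arrow_tail (extra_arrows i bs))"
proof (induction bs arbitrary: i)
  case (Cons b bs)
  then show ?case
    using extra_arrows_tail_ge[of _ "Suc i" bs]
    by (fastforce simp: sorted_append comp_def map_replicate_const)
qed simp


section \<open>The quiver of the reconstruction algebra\<close>

locale recon =
  fixes \<alpha> :: "nat list"
  assumes nonempty: "\<alpha> \<noteq> []"
begin

abbreviation Q where "Q \<equiv> recon_quiver \<alpha>"
definition n where "n = length \<alpha>"
definition m where "m = length (k_arrows \<alpha>) - 1"
definition k where "k h = k_arrows \<alpha> ! h"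
definition l where "l h = arrow_tail (k h)"
text \<open>Here arrows are indexed by their heads in \<open>1..n\<close>, whereas the constructors
  carry tails. The arrows \<open>Cw 1\<close> and \<open>Acw n\<close> into 0 appear instead as
  \<open>k 0\<close> and \<open>k m\<close>.\<close>

definition cw where "cw v = Cw (if v = n then 0 else Suc v)"
definition acw where "acw v = Acw (v - 1)"
definition \<beta> where "\<beta> = gaps (map arrow_tail (k_arrows \<alpha>))"
text \<open>Indices shift by one, as the \<open>k h\<close> are counted from 0: these are
  \<open>x_{h+1}\<close> and \<open>y_{h+1}\<close>.\<close>

definition zx :: "nat \<Rightarrow> nat \<times> nat" where "zx h = (h, 0)"
definition zy where "zy h = (Suc h, s_idx \<beta> (Suc h))"

text \<open>\<open>block v\<close> is the \<open>t\<close> with \<open>l (t - 1) \<le> v < l t\<close>: the variables \<open>z\<^sub>t\<^sub>,\<^sub>1, z\<^sub>t\<^sub>,\<^sub>2, \<dots>\<close> occurring in \<open>W\<^sub>t\<close>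
  are assigned to the two-cycles at \<open>v = l (t - 1), l (t - 1) + 1, \<dots>\<close>.\<close>

definition block where "block v = (LEAST t. v < l t)"
definition zv where "zv v = (block v, Suc (v - l (block v - 1)))"

lemma n_pos: "1 \<le> n"
  using nonempty by (simp add: n_def Suc_le_eq)

lemma length_k: "length (k_arrows \<alpha>) = Suc m"
  by (simp add: m_def k_arrows_def)

lemma length_\<beta>: "length \<beta> = m"
  by (simp add: \<beta>_def length_gaps length_k)

lemma k_image: "k ` {..m} = set (k_arrows \<alpha>)"
  by (auto simp: k_def set_conv_nth length_k less_Suc_eq_le)

lemma set_k: "set (k_arrows \<alpha>) = {Cw 1, Acw n} \<union>
    {Extra i j |i j. 1 \<le> i \<and> i \<le> n \<and> 1 \<le> j \<and> j \<le> \<alpha> ! (i - 1) - 2}"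
  by (auto simp: k_arrows_def set_extra_arrows n_def)

lemma k_cases:
  assumes "h \<le> m"
  obtains "k h = Cw 1" | "k h = Acw n" | i j where "k h = Extra i j" "1 \<le> i" "i \<le> n"
proof -
  have "k h \<in> set (k_arrows \<alpha>)" using assms k_image by blast
  then show thesis using that unfolding set_k by blast
qed

lemma distinct_k: "distinct (k_arrows \<alpha>)"
  by (auto simp: k_arrows_def set_extra_arrows distinct_extra_arrows)

lemma sorted_l: "sorted (map arrow_tail (k_arrows \<alpha>))"
  using n_pos
  by (auto simp: k_arrows_def sorted_append sorted_extra_arrows set_extra_arrows n_def)

lemma l_0: "l 0 = 1"
  by (simp add: l_def k_def k_arrows_def)

lemma l_m: "l m = n"
  by (simp add: l_def k_def k_arrows_def m_def nth_append n_def)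

lemma l_mono: "i \<le> j \<Longrightarrow> j \<le> m \<Longrightarrow> l i \<le> l j"
  using sorted_nth_mono[OF sorted_l, of i j] by (simp add: l_def k_def length_k)

lemma l_range: "h \<le> m \<Longrightarrow> 1 \<le> l h \<and> l h \<le> n"
  using l_mono[of 0 h] l_mono[of h m] by (simp add: l_0 l_m)

text \<open>Hence \<open>W_t\<close> has \<open>l t - l (t - 1)\<close> factors, as many as there
  are two-cycles in block \<open>t\<close>.\<close>

lemma s_idx_\<beta>: "t < m \<Longrightarrow> s_idx \<beta> (Suc t) = Suc (l (Suc t) - l t)"
  by (simp add: s_idx_def length_\<beta>) (simp add: \<beta>_def nth_gaps length_k l_def k_def)

lemma s_idx_last: "s_idx \<beta> (Suc m) = 0"
  by (simp add: s_idx_def length_\<beta>)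

lemma block_props:
  assumes v: "v \<in> {1..<n}"
  shows "1 \<le> block v" "block v \<le> m" "l (block v - 1) \<le> v" "v < l (block v)"
proof -
  have m: "v < l m" using v by (simp add: l_m)
  show 1: "v < l (block v)" unfolding block_def by (rule LeastI[of _ m]) (rule m)
  show "block v \<le> m" unfolding block_def by (rule Least_le) (rule m)
  show 2: "1 \<le> block v" using 1 v by (cases "block v") (auto simp: l_0)
  have "block v - 1 < block v" using 2 by simp
  then show "l (block v - 1) \<le> v"
    using not_less_Least[of "block v - 1" "\<lambda>t. v < l t"] by (simp add: block_def)
qed

lemma block_eqI:
  assumes "t < m" "l t \<le> v" "v < l (Suc t)"
  shows "block v = Suc t"
  unfolding block_def
proof (rule Least_equality)
  fix q assume "v < l q"
  then show "Suc t \<le> q"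
    using assms l_mono[of q t] by (cases "q \<le> t") auto
qed fact

lemma zv_eq:
  assumes "t < m" "l t \<le> v" "v < l (Suc t)"
  shows "zv v = (Suc t, Suc (v - l t))"
  by (simp add: zv_def block_eqI[OF assms])

lemma zv_E:
  assumes "v \<in> {1..<n}"
  obtains t where "t < m" "l t \<le> v" "v < l (Suc t)" "zv v = (Suc t, Suc (v - l t))"
proof -
  from block_props[OF assms] show thesis
    by (intro that[of "block v - 1"]) (auto simp: zv_def)
qed

sublocale cycle_monomials n m l k cw acw zx zy zv
proof
  show "1 \<le> n" by (rule n_pos)
  show "l i \<le> l j" if "i \<le> j" "j \<le> m" for i j using that by (rule l_mono)
  show "1 \<le> l h \<and> l h \<le> n" if "h \<le> m" for h using that by (rule l_range)
  show "k g = k h \<longleftrightarrow> g = h" if "g \<le> m" "h \<le> m" for g h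
    using that nth_eq_iff_index_eq[OF distinct_k] by (simp add: k_def length_k)
  show "cw v = cw w \<longleftrightarrow> v = w" if "v \<in> {1..n}" "w \<in> {1..n}" for v w
    using that by (auto simp: cw_def)
  show "acw v = acw w \<longleftrightarrow> v = w" if "v \<in> {1..n}" "w \<in> {1..n}" for v w
    using that by (auto simp: acw_def)
  show "k h \<noteq> cw v" if "h \<le> m" "v \<in> {1..n}" for h v
    using that by (auto simp: cw_def elim: k_cases[of h])
  show "k h \<noteq> acw v" if "h \<le> m" "v \<in> {1..n}" for h v
    using that by (auto simp: acw_def elim: k_cases[of h])
  show "cw v \<noteq> acw w" if "v \<in> {1..n}" "w \<in> {1..n}" for v w
    by (simp add: cw_def acw_def)
  show "zx g = zx h \<longleftrightarrow> g = h" if "g \<le> m" "h \<le> m" for g h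
    by (simp add: zx_def)
  show "zy g = zy h \<longleftrightarrow> g = h" if "g \<le> m" "h \<le> m" for g h
    by (auto simp: zy_def)
  show "zv v = zv w \<longleftrightarrow> v = w" if "v \<in> {1..<n}" "w \<in> {1..<n}" for v w
    using zv_E[OF that(1)] zv_E[OF that(2)]
    by (metis Pair_inject Suc_inject eq_diff_iff)
  \<comment> \<open>The second coordinate of \<open>zy h\<close> vanishes only for
    \<open>h = m\<close>, and then its first coordinate \<open>Suc m\<close> exceeds every
    \<open>g\<close>.\<close>
  show "zx g \<noteq> zy h" if "g \<le> m" "h \<le> m" for g h
    using that s_idx_\<beta>[of h] by (cases "h = m") (auto simp: zx_def zy_def)
  show "zx h \<noteq> zv v" if "h \<le> m" "v \<in> {1..<n}" for h v
    by (simp add: zx_def zv_def)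
  show "zy h \<noteq> zv v" if "h \<le> m" and v: "v \<in> {1..<n}" for h v
  proof
    assume eq: "zy h = zv v"
    obtain t where t: "t < m" "l t \<le> v" "v < l (Suc t)" "zv v = (Suc t, Suc (v - l t))"
      using zv_E[OF v] .
    then have "h = t" "s_idx \<beta> (Suc t) = Suc (v - l t)" using eq by (auto simp: zy_def)
    then show False using t by (simp add: s_idx_\<beta>)
  qed
qed

text \<open>In row \<open>t\<close> with \<open>1 \<le> t \<le> m\<close>, the first variable is an
  x, the last a y, and those in between are the two-cycles of block \<open>t\<close>. The remaining
  variables \<open>(0, 0)\<close> and \<open>(Suc m, 0)\<close> are \<open>zx 0\<close> and
  \<open>zy m\<close>.\<close>

lemma Z_eq: "Z = z_vars \<beta>"
proof (intro equalityI subsetI)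
  fix z assume "z \<in> Z"
  then consider h where "h \<le> m" "z = zx h" | h where "h \<le> m" "z = zy h"
    | v where "v \<in> {1..<n}" "z = zv v"
    unfolding Z_def by blast
  then show "z \<in> z_vars \<beta>"
  proof cases
    case 1
    then show ?thesis by (cases "h = 0") (auto simp: zx_def z_vars_def length_\<beta>)
  next
    case 2
    then show ?thesis
      by (cases "h = m") (auto simp: zy_def z_vars_def length_\<beta> s_idx_last)
  next
    case 3
    obtain t where t: "t < m" "l t \<le> v" "v < l (Suc t)" "zv v = (Suc t, Suc (v - l t))"
      using zv_E[OF 3(1)] .
    then show ?thesis using 3 by (auto simp: z_vars_def length_\<beta> s_idx_\<beta>)
  qed
next
  fix z assume "z \<in> z_vars \<beta>"
  then consider "z = (0, 0)" | "z = (Suc m, 0)" | i j where "z = (i, j)" "1 \<le> i" "i \<le> m" "j \<le> s_idx \<beta> i"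
    unfolding z_vars_def length_\<beta> by auto
  then show "z \<in> Z"
  proof cases
    case 1
    then show ?thesis by (auto simp: Z_def zx_def)
  next
    case 2
    then have "z = zy m" by (simp add: zy_def s_idx_last)
    then show ?thesis by (auto simp: Z_def)
  next
    case 3
    then obtain t where t: "i = Suc t" "t < m" by (cases i) auto
    consider "j = 0" | "j = s_idx \<beta> i" | "j \<noteq> 0" "j < s_idx \<beta> i" using 3 by linarith
    then show ?thesis
    proof cases
      case 1
      then show ?thesis using 3 by (auto simp: Z_def zx_def)
    next
      case 2
      then have "z = zy t" using 3 t by (simp add: zy_def)
      then show ?thesis using t by (auto simp: Z_def)
    next
      case j: 3
      define v where "v = l t + (j - 1)"
      have v: "l t \<le> v" "v < l (Suc t)" "v - l t = j - 1"
        using j t l_mono[of t "Suc t"] by (auto simp: v_def s_idx_\<beta>)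
      then have "zv v = z" using zv_eq[of t v] t 3 j by simp
      moreover have "v \<in> {1..<n}" using v t l_range[of t] l_range[of "Suc t"] by auto
      ultimately show ?thesis by (auto simp: Z_def)
    qed
  qed
qed

section \<open>Quasiminors as straightening binomials\<close>

lemma prod_Var: "finite A \<Longrightarrow> (\<Prod>v\<in>A. Var (f v)) = monom_of (\<Sum>v\<in>A. Poly_Mapping.single (f v) 1)"
  by (induction A rule: finite_induct) (simp_all add: Var_def mult_single del: One_nat_def)

lemma W_prod_eq:
  assumes "t < m"
  shows "W_prod \<beta> (Suc t) = (\<Prod>v\<in>{l t..<l (Suc t)}. Var (zv v))"
proof -
  have "(\<Prod>v\<in>{l t..<l (Suc t)}. Var (zv v)) = (\<Prod>j\<in>{1..<s_idx \<beta> (Suc t)}. Var (Suc t, j))"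
    using l_mono[of t "Suc t"] assms
    by (intro prod.reindex_bij_witness[of _ "\<lambda>j. l t + j - 1" "\<lambda>v. Suc (v - l t)"])
      (auto simp: s_idx_\<beta> zv_eq)
  then show ?thesis by (simp add: W_prod_def)
qed

text \<open>The blocks are consecutive intervals of vertices, so their products concatenate; equal
  successive tails give an empty block and \<open>W_t = 1\<close>.\<close>

lemma prod_W_prod:
  assumes "i \<le> j" "j \<le> m"
  shows "(\<Prod>t\<in>{Suc i..<Suc j}. W_prod \<beta> t) = (\<Prod>v\<in>{l i..<l j}. Var (zv v))"
  using assms
proof (induction j rule: dec_induct)
  case (step j)
  then have "(\<Prod>t\<in>{Suc i..<Suc (Suc j)}. W_prod \<beta> t)
      = (\<Prod>v\<in>{l i..<l j}. Var (zv v)) * (\<Prod>v\<in>{l j..<l (Suc j)}. Var (zv v))"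
    by (simp add: W_prod_eq)
  also have "\<dots> = (\<Prod>v\<in>{l i..<l (Suc j)}. Var (zv v))"
    using step l_mono[of i j] l_mono[of j "Suc j"] by (intro prod.atLeastLessThan_concat) auto
  finally show ?case .
qed simp

lemma quasiminor_eq:
  assumes ij: "i < j" "j \<le> m"
  shows "quasiminor \<beta> (Suc i) (Suc j)
    = monom_of (Poly_Mapping.single (zx i) 1 + Poly_Mapping.single (zy j) 1) - monom_of (straightened i j)"
proof -
  have "x_var (Suc i) = monom_of (Poly_Mapping.single (zx i) 1)" for i
    by (simp add: x_var_def Var_def zx_def)
  moreover have "y_var \<beta> (Suc i) = monom_of (Poly_Mapping.single (zy i) 1)" for i
    by (simp add: y_var_def Var_def zy_def)
  moreover have "(\<Prod>t\<in>{Suc i..<Suc j}. W_prod \<beta> t)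
      = monom_of (\<Sum>v\<in>{l i..<l j}. Poly_Mapping.single (zv v) 1)"
    using ij by (simp only: prod_W_prod prod_Var finite_atLeastLessThan less_imp_le)
  ultimately show ?thesis
    by (simp only: quasiminor_def straightened_def mult_single mult_1_left)
qed

section \<open>Circulations on the quiver\<close>

lemma arcs_Q: "arcs Q = arrows"
proof -
  have "Cw ` {0..n} = insert (Cw 1) (cw ` {1..n})"
  proof (intro equalityI subsetI)
    fix p assume "p \<in> Cw ` {0..n}"
    then obtain i where i: "p = Cw i" "i \<le> n" by auto
    then consider "i = 0" | "i = 1" | "2 \<le> i" by linarith
    then show "p \<in> insert (Cw 1) (cw ` {1..n})"
    proof cases
      case 1
      then have "p = cw n" using i by (simp add: cw_def)
      then show ?thesis using n_pos by simp
    next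
      case 3
      then have "p = cw (i - 1)" "i - 1 \<in> {1..n}" using i by (auto simp: cw_def)
      then show ?thesis by simp
    qed (use i in simp)
  qed (use n_pos in \<open>auto simp: cw_def\<close>)
  moreover have "Acw ` {0..n} = insert (Acw n) (acw ` {1..n})"
  proof (intro equalityI subsetI)
    fix p assume "p \<in> Acw ` {0..n}"
    then obtain i where i: "p = Acw i" "i \<le> n" by auto
    then show "p \<in> insert (Acw n) (acw ` {1..n})"
      by (cases "i = n") (auto simp: acw_def intro!: rev_image_eqI[of "Suc i"])
  qed (auto simp: acw_def)
  ultimately show ?thesis
    unfolding arrows_def k_image set_k by (auto simp: recon_quiver_def Let_def n_def)
qed

lemma verts_Q: "verts Q = {0..n}"
  by (simp add: recon_quiver_def Let_def n_def)

lemma head_tail_Q: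
  "h \<le> m \<Longrightarrow> tail Q (k h) = l h"
  "h \<le> m \<Longrightarrow> head Q (k h) = 0"
  "v \<in> {1..n} \<Longrightarrow> tail Q (cw v) = (if v = n then 0 else Suc v)"
  "v \<in> {1..n} \<Longrightarrow> head Q (cw v) = v"
  "v \<in> {1..n} \<Longrightarrow> tail Q (acw v) = v - 1"
  "v \<in> {1..n} \<Longrightarrow> head Q (acw v) = v"
  by (auto simp: recon_quiver_def Let_def n_def[symmetric] l_def cw_def acw_def elim: k_cases[of h])

lemma in_arcs_Q: "q \<in> {1..n} \<Longrightarrow> in_arcs Q q = {cw q, acw q}"
  by (auto simp: in_arcs_def arcs_Q arrows_def head_tail_Q)

lemma out_arcs_Q:
  assumes "q \<in> {1..n}"
  shows "out_arcs Q q = (if 2 \<le> q then {cw (q - 1)} else {})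
    \<union> (if q < n then {acw (q + 1)} else {}) \<union> k ` {h. h \<le> m \<and> l h = q}" (is "_ = ?R")
proof (intro equalityI subsetI)
  fix p assume "p \<in> out_arcs Q q"
  then have "tail Q p = q" "p \<in> arrows" by (auto simp: out_arcs_def arcs_Q)
  then show "p \<in> ?R" using assms unfolding arrows_def
    by (auto simp: head_tail_Q split: if_splits) (metis diff_Suc_1 One_nat_def)
next
  fix p assume "p \<in> ?R"
  then consider "2 \<le> q" "p = cw (q - 1)" | "q < n" "p = acw (q + 1)" | h where "h \<le> m" "l h = q" "p = k h"
    by (auto split: if_splits)
  then show "p \<in> out_arcs Q q"
  proof cases
    case 1
    then have "q - 1 \<in> {1..n}" "q - 1 \<noteq> n" "Suc (q - 1) = q" using assms by auto
    then show ?thesis using 1 head_tail_Q(3)[of "q - 1"] by (simp add: out_arcs_def arcs_Q arrows_def)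
  next
    case 2
    then have "q + 1 \<in> {1..n}" by auto
    then show ?thesis using 2 head_tail_Q(5)[of "q + 1"] by (simp add: out_arcs_def arcs_Q arrows_def)
  next
    case 3
    then show ?thesis by (simp add: out_arcs_def arcs_Q arrows_def head_tail_Q)
  qed
qed

lemma sum_in_arcs_Q:
  "q \<in> {1..n} \<Longrightarrow> (\<Sum>p\<in>in_arcs Q q. f p) = f (cw q) + (f (acw q) :: nat)"
  using cw_acw[of q q] by (simp add: in_arcs_Q)

lemma sum_out_arcs_Q:
  assumes q: "q \<in> {1..n}"
  shows "(\<Sum>p\<in>out_arcs Q q. f p) = (if 2 \<le> q then f (cw (q - 1)) else 0)
    + (if q < n then f (acw (q + 1)) else 0) + (\<Sum>h | h \<le> m \<and> l h = q. f (k h) :: nat)"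
proof -
  let ?A = "if 2 \<le> q then {cw (q - 1)} else {}" and ?B = "if q < n then {acw (q + 1)} else {}"
    and ?C = "k ` {h. h \<le> m \<and> l h = q}"
  have a: "q - 1 \<in> {1..n}" if "2 \<le> q" using q that by auto
  have b: "q + 1 \<in> {1..n}" if "q < n" using that by auto
  have "?A \<inter> ?B = {}" using cw_acw[OF a b] by auto
  moreover have "(?A \<union> ?B) \<inter> ?C = {}"
  proof -
    have "cw (q - 1) \<noteq> k h" if "h \<le> m" "2 \<le> q" for h using K_cw[OF that(1) a[OF that(2)]] by metis
    moreover have "acw (q + 1) \<noteq> k h" if "h \<le> m" "q < n" for h using K_acw[OF that(1) b[OF that(2)]] by metis
    ultimately show ?thesis by auto
  qed
  ultimately have "(\<Sum>p\<in>out_arcs Q q. f p) = sum f ?A + sum f ?B + sum f ?C"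
    unfolding out_arcs_Q[OF q] by (subst sum.union_disjoint, simp, simp, simp, subst sum.union_disjoint) auto
  moreover have "sum f ?C = (\<Sum>h | h \<le> m \<and> l h = q. f (k h))"
    by (subst sum.reindex) (auto simp: inj_on_def inj_K)
  ultimately show ?thesis by simp
qed

text \<open>Total inflow and total outflow both equal the sum over all arrows, so conservation at
  \<open>1..n\<close> forces it at the vertex 0, where \<open>balanced\<close> imposes no
  condition.\<close>

lemma circulations_Q: "circulations Q = {e \<in> mons arrows. balanced e}"
proof -
  interpret fin_digraph Q by (rule fin_digraph_recon_quiver)
  have vQ: "verts Q = insert 0 {1..n}" by (auto simp: verts_Q)
  have "(\<forall>q\<in>verts Q. (\<Sum>p\<in>in_arcs Q q. f p) = (\<Sum>p\<in>out_arcs Q q. f p))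
    \<longleftrightarrow> (\<forall>q\<in>{1..n}. (\<Sum>p\<in>in_arcs Q q. f p) = (\<Sum>p\<in>out_arcs Q q. f p))" for f :: "arrow \<Rightarrow> nat"
  proof
    assume *: "\<forall>q\<in>{1..n}. (\<Sum>p\<in>in_arcs Q q. f p) = (\<Sum>p\<in>out_arcs Q q. f p)"
    have "(\<Sum>q\<in>verts Q. \<Sum>p\<in>in_arcs Q q. f p) = (\<Sum>p\<in>arcs Q. f p)"
      unfolding in_arcs_def by (intro sum.group) auto
    moreover have "(\<Sum>q\<in>verts Q. \<Sum>p\<in>out_arcs Q q. f p) = (\<Sum>p\<in>arcs Q. f p)"
      unfolding out_arcs_def by (intro sum.group) auto
    moreover have "(\<Sum>q\<in>verts Q. g q) = g 0 + (\<Sum>q\<in>{1..n}. g q)" for g :: "nat \<Rightarrow> nat"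
      by (simp add: verts_Q sum.atLeast_Suc_atMost)
    moreover have "(\<Sum>q\<in>{1..n}. \<Sum>p\<in>in_arcs Q q. f p) = (\<Sum>q\<in>{1..n}. \<Sum>p\<in>out_arcs Q q. f p)"
      by (rule sum.cong[OF refl]) (use * in blast)
    ultimately have "(\<Sum>p\<in>in_arcs Q 0. f p) = (\<Sum>p\<in>out_arcs Q 0. f p)" by simp
    with * show "\<forall>q\<in>verts Q. (\<Sum>p\<in>in_arcs Q q. f p) = (\<Sum>p\<in>out_arcs Q q. f p)"
      by (simp only: vQ ball_simps simp_thms)
  qed (simp add: verts_Q)
  then show ?thesis
    unfolding circulations_def balanced_def arcs_Q by (simp add: sum_in_arcs_Q sum_out_arcs_Q)
qed

theorem invariant_ring_iso:
  "calg_iso (invariant_ring Q) Const (poly_ring (z_vars \<beta>) Quot QDet \<beta>)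
     (\<lambda>c. QDet \<beta> +>\<^bsub>poly_ring (z_vars \<beta>)\<^esub> Const c)"
proof -
  interpret fin_digraph Q by (rule fin_digraph_recon_quiver)
  let ?S = "{quasiminor \<beta> i j |i j. 1 \<le> i \<and> i < j \<and> j \<le> length \<beta> + 1}"
  have gen: "\<exists>i j. i < j \<and> j \<le> m \<and> f = monom_of (Poly_Mapping.single (zx i) 1 + Poly_Mapping.single (zy j) 1)
      - monom_of (straightened i j)" if "f \<in> ?S" for f
  proof -
    from that obtain i j where ij: "1 \<le> i" "i < j" "j \<le> Suc m" "f = quasiminor \<beta> i j"
      by (auto simp: length_\<beta>)
    then show ?thesis using quasiminor_eq[of "i - 1" "j - 1"]
      by (intro exI[of _ "i - 1"] exI[of _ "j - 1"]) auto
  qed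
  have genideal: "QDet \<beta> = genideal (poly_ring Z) ?S" by (simp add: QDet_def Z_eq)
  have S: "?S \<subseteq> carrier (poly_ring Z)"
  proof
    interpret R: cring "poly_ring Z" by (rule cring_poly_ring)
    fix f assume "f \<in> ?S"
    then obtain i j where ij: "i < j" "j \<le> m" and f: "f = monom_of (Poly_Mapping.single (zx i) 1
      + Poly_Mapping.single (zy j) 1) - monom_of (straightened i j)" using gen by blast
    have "monom_of (Poly_Mapping.single (zx i) 1 + Poly_Mapping.single (zy j) 1) \<in> carrier (poly_ring Z)"
      using ij by (intro monom_of_carrier mons_add mons_single) (auto simp: Z_def)
    moreover have "monom_of (straightened i j) \<in> carrier (poly_ring Z)"
      by (intro monom_of_carrier straightened_mons ij)
    ultimately show "f \<in> carrier (poly_ring Z)"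
      using R.minus_closed by (simp only: f poly_ring_minus[symmetric])
  qed
  have I: "ideal (genideal (poly_ring Z) ?S) (poly_ring Z)"
    by (intro ring.genideal_ideal S cring.axioms(1) cring_poly_ring)
  \<comment> \<open>\<open>invariant_ring\<close> only restricts the carrier of the polynomial ring
    in the arrows, which is the shape required by \<open>toric_iso\<close>.\<close>
  have "calg_iso ((poly_ring (arcs Q))\<lparr>carrier := carrier (invariant_ring Q)\<rparr>) Const
    (poly_ring Z Quot genideal (poly_ring Z) ?S)
    (\<lambda>c. genideal (poly_ring Z) ?S +>\<^bsub>poly_ring Z\<^esub> Const c)"
  proof (rule toric_iso[of \<pi>])
    show "push \<pi> f = 0" if "f \<in> ?S" for f
      using gen[OF that] \<pi>_straightened by (auto simp: push_diff)
    show "monom_of u - monom_of u' \<in> genideal (poly_ring Z) ?S"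
      if "u \<in> mons Z" "u' \<in> mons Z" "\<pi> u = \<pi> u'" for u u'
    proof (rule fibre_binomial[OF I _ that])
      fix i j assume ij: "i < j" "j \<le> m"
      have "quasiminor \<beta> (Suc i) (Suc j) \<in> ?S" using ij by (auto simp: length_\<beta>)
      then have "quasiminor \<beta> (Suc i) (Suc j) \<in> genideal (poly_ring Z) ?S"
        using ring.genideal_self[OF cring.axioms(1)[OF cring_poly_ring] S] by blast
      then show "monom_of (Poly_Mapping.single (zx i) 1 + Poly_Mapping.single (zy j) 1)
        - monom_of (straightened i j) \<in> genideal (poly_ring Z) ?S"
        by (simp only: quasiminor_eq[OF ij])
    qed
  qed (simp_all only: \<pi>_zero \<pi>_add S carrier_invariant_ring circulations_Q image_\<pi>)
  then show ?thesis
    by (simp add: genideal Z_eq invariant_ring_def)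
qed

end

theorem theorem1p1:
  fixes r a :: nat and \<alpha> \<beta> :: "nat list"
  assumes "1 \<le> a" and "a < r" and "coprime r a"
    and "hj_expansion (of_nat r / of_nat a) \<alpha>"
    and "hj_expansion (of_nat r / of_nat (r - a)) \<beta>"
  shows "calg_iso
    (invariant_ring (recon_quiver \<alpha>)) Const
    (poly_ring (z_vars \<beta>) Quot QDet \<beta>)
    (\<lambda>c. QDet \<beta> +>\<^bsub>poly_ring (z_vars \<beta>)\<^esub> Const c)"
proof -
  interpret recon \<alpha> by standard (use assms(4) in \<open>simp add: hj_expansion_def\<close>)
  \<comment> \<open>This identifies the dual value, so that uniqueness of expansions makes the given
    \<open>\<beta>\<close> the list of gaps between the tails.\<close>
  have "(of_nat r / of_nat a :: rat) / (of_nat r / of_nat a - 1) = of_nat r / of_nat (r - a)"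
  proof -
    have "(of_nat r / of_nat a :: rat) - 1 = of_nat (r - a) / of_nat a"
      using assms(1,2) by (simp add: of_nat_diff diff_divide_distrib)
    then show ?thesis using assms(1) by simp
  qed
  with hj_expansion_dual[OF assms(4)] have "recon.\<beta> \<alpha> = \<beta>"
    using hj_expansion_unique[OF _ assms(5)] by (simp only: \<beta>_def)
  then show ?thesis using invariant_ring_iso by simp
qed

end
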